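(* Let $E$ be a metric space and let $\boldsymbol{\mu}=\{\mu_t(\xi,\cdot)\}_{t\in\mathbb{R}^+,\,\xi\in E}\subset\mathbf{ca}^+(E)$ be a family satisfying conditions (A1)–(A5) of the context. Let $T=\{T_t\}_{t\in\mathbb{R}^+}$ be defined by $$T_tf(\xi)=\int_Ef(\xi')\,\mu_t(\xi,d\xi'),\qquad f\in C_b(E),\ \xi\in E,\ t\in\mathbb{R}^+.$$ Then $T$ is a $C_0$-sequentially locally equicontinuous semigroup on $(C_b(E),\tau_{\mathcal{K}})$. Moreover, for every $\alpha>0$, the normalized semigroup $\{e^{-\alpha t}T_t\}_{t\in\mathbb{R}^+}$ is a $C_0$-sequentially equicontinuous semigroup on $(C_b(E),\tau_{\mathcal{K}})$ such that, for every $f\in C_b(E)$ and $\lambda>0$, the generalized Riemann integral $\int_0^{+\infty}e^{-\lambda t}e^{-\alpha t}T_tf\,dt$ exists in $(C_b(E),\tau_{\mathcal{K}})$.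
   Context: $\mathbb{R}^+=[0,+\infty)$; $C_b(E)$ is the space of bounded continuous real-valued functions on $E$; $\mathbf{ca}(E)$ (resp. $\mathbf{ca}^+(E)$) is the set of countably additive finite signed (resp. positive) measures on the Borel $\sigma$-algebra $\mathcal{E}$ of $E$, with total variation norm. $\tau_{\mathcal{K}}$ is the locally convex topology on $C_b(E)$ generated by the seminorms $p_{K,\mu}(f)=\sup_{x\in K}|f(x)|+\left|\int_Ef\,d\mu\right|$, with $K$ ranging over the non-empty compact subsets of $E$ and $\mu$ over $\mathbf{ca}(E)$. Conditions on $\boldsymbol{\mu}$ (the $\mu_t(\xi,\cdot)$ are not required to be probability measures): (A1) $\boldsymbol{\mu}$ is bounded in $\mathbf{ca}^+(E)$ and $\mu_0(\xi,\Gamma)=\mathbf{1}_\Gamma(\xi)$ for every $\xi\in E$, $\Gamma\in\mathcal{E}$; (A2) for every $f\in C_b(E)$ and $t\in\mathbb{R}^+$, the map $E\to\mathbb{R}$, $\xi\mapsto\int_Ef(\xi')\mu_t(\xi,d\xi')$, is continuous; (A3) for every $f\in C_b(E)$, $t,s\in\mathbb{R}^+$, $\xi\in E$: $\int_Ef(\xi')\mu_{t+s}(\xi,d\xi')=\int_E\left(\int_Ef(\xi'')\mu_t(\xi',d\xi'')\right)\mu_s(\xi,d\xi')$; (A4) for every $\hat t>0$ and every compact $K\subset E$, the family $\{\mu_t(\xi,\cdot):t\in[0,\hat t],\xi\in K\}$ is tight, i.e. for every $\epsilon>0$ there is a compact $K_0\subset E$ with $\mu_t(\xi,K_0)>\mu_t(\xi,E)-\epsilon$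 for all $t\in[0,\hat t]$, $\xi\in K$; (A5) for every $r>0$ and every non-empty compact $K\subset E$, $\lim_{t\to0^+}\sup_{\xi\in K}|\mu_t(\xi,B(\xi,r))-1|=0$, where $B(\xi,r)$ is the open ball. A family $\{f_\iota\}_{\iota\in\mathcal{I}}$ of maps from a topological vector space $Z$ to itself is sequentially equicontinuous if for every $z_n\to z$ in $Z$ and every neighborhood $U$ of $0$ there is $\overline n$ with $f_\iota(z_n)\in f_\iota(z)+U$ for all $\iota\in\mathcal{I}$, $n\ge\overline n$. A family of linear operators $\{T_t\}_{t\in\mathbb{R}^+}$ on a Hausdorff locally convex space $Z$ is a $C_0$-sequentially equicontinuous (resp. $C_0$-sequentially locally equicontinuous) semigroup if $T_0=I$, $T_{t+s}=T_tT_s$, $\lim_{t\to0^+}T_tz=z$ for all $z\in Z$, and $\{T_t\}_{t\in\mathbb{R}^+}$ is sequentially equicontinuous (resp. $\{T_t\}_{t\in[0,R]}$ is sequentially equicontinuous for every $R>0$). The generalized Riemann integral over $[0,+\infty)$ exists if the Riemann integrals over $[0,a]$ exist for all $a\ge0$ and converge as $a\to+\infty$. *)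

theory Defs
  imports "HOL-Analysis.Analysis"
begin

section \<open>Signed measures\<close>

text \<open>
  A signed measure is represented by its set function, of which only the values on Borel sets
  matter. A positive measure \<open>M\<close> in \<open>ca_pos\<close> corresponds to the element \<open>measure M\<close> of \<open>ca\<close>
  (lemma \<open>measure_in_ca\<close> below).
\<close>

definition ca :: "('a::topological_space set \<Rightarrow> real) set" where
  "ca = {\<nu>. \<forall>A::nat \<Rightarrow> 'a set. range A \<subseteq> sets borel \<longrightarrow> disjoint_family A \<longrightarrow>
               (\<lambda>i. \<nu> (A i)) sums \<nu> (\<Union>i. A i)}"

definition ca_pos :: "'a::topological_space measure set" where
  "ca_pos = {M. sets M = sets borel \<and> finite_measure M}"

definition variation :: "('a::topological_space set \<Rightarrow> real) \<Rightarrow> 'a set \<Rightarrow> real" where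
  "variation \<nu> A =
     (SUP P \<in> {P. finite P \<and> disjoint P \<and> P \<subseteq> sets borel \<and> \<Union>P = A}. \<Sum>B\<in>P. \<bar>\<nu> B\<bar>)"

definition ca_norm :: "('a::topological_space set \<Rightarrow> real) \<Rightarrow> real" where
  "ca_norm \<nu> = variation \<nu> UNIV"

text \<open>The Jordan decomposition \<open>\<nu> = \<nu>\<^sup>+ - \<nu>\<^sup>-\<close> with \<open>\<nu>\<^sup>\<plusminus> = (\<bar>\<nu>\<bar> \<plusminus> \<nu>) / 2\<close>.\<close>

definition pos_part :: "('a::topological_space set \<Rightarrow> real) \<Rightarrow> 'a measure" where
  "pos_part \<nu> = measure_of UNIV (sets borel) (\<lambda>A. ennreal ((variation \<nu> A + \<nu> A) / 2))"

definition neg_part :: "('a::topological_space set \<Rightarrow> real) \<Rightarrow> 'a measure" where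
  "neg_part \<nu> = measure_of UNIV (sets borel) (\<lambda>A. ennreal ((variation \<nu> A - \<nu> A) / 2))"

definition ca_integral :: "('a::topological_space set \<Rightarrow> real) \<Rightarrow> ('a \<Rightarrow> real) \<Rightarrow> real" where
  "ca_integral \<nu> f = (\<integral>x. f x \<partial>pos_part \<nu>) - (\<integral>x. f x \<partial>neg_part \<nu>)"


section \<open>Locally convex topologies\<close>

text \<open>
  The space on which a topology \<open>X\<close> is considered below is a whole type of class
  \<open>real_vector\<close>; any topology that the type carries through type classes plays no role.
\<close>

definition hausdorff_lcs :: "'b::real_vector topology \<Rightarrow> bool" where
  "hausdorff_lcs X \<longleftrightarrow>
     topspace X = UNIV \<and>
     continuous_map (prod_topology X X) X (\<lambda>(x, y). x + y) \<and>
     continuous_map (prod_topology euclideanreal X) X (\<lambda>(c, x). c *\<^sub>R x) \<and>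
     Hausdorff_space X \<and>
     (\<forall>U. openin X U \<longrightarrow> 0 \<in> U \<longrightarrow> (\<exists>V. openin X V \<and> 0 \<in> V \<and> convex V \<and> V \<subseteq> U))"

definition nbhd0 :: "'b::real_vector topology \<Rightarrow> 'b set \<Rightarrow> bool" where
  "nbhd0 X U \<longleftrightarrow> (\<exists>V. openin X V \<and> 0 \<in> V \<and> V \<subseteq> U)"

definition seminorm_topology :: "('b::real_vector \<Rightarrow> real) set \<Rightarrow> 'b topology" where
  "seminorm_topology P = topology_generated_by {{y. p (y - x) < e} |p x e. p \<in> P \<and> e > 0}"

definition p_seminorm ::
  "'a::topological_space set \<Rightarrow> ('a set \<Rightarrow> real) \<Rightarrow> ('a \<Rightarrow>\<^sub>C real) \<Rightarrow> real" where
  "p_seminorm K \<nu> f = (SUP x\<in>K. \<bar>f x\<bar>) + \<bar>ca_integral \<nu> f\<bar>"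

definition tau_K :: "('a::topological_space \<Rightarrow>\<^sub>C real) topology" where
  "tau_K = seminorm_topology {p_seminorm K \<nu> |K \<nu>. compact K \<and> K \<noteq> {} \<and> \<nu> \<in> ca}"


section \<open>Sequentially equicontinuous semigroups\<close>

definition seq_equicontinuous ::
  "'b::real_vector topology \<Rightarrow> 'i set \<Rightarrow> ('i \<Rightarrow> 'b \<Rightarrow> 'b) \<Rightarrow> bool" where
  "seq_equicontinuous X I f \<longleftrightarrow>
     (\<forall>zs z U. limitin X zs z sequentially \<longrightarrow> nbhd0 X U \<longrightarrow>
        (\<exists>N. \<forall>i\<in>I. \<forall>n\<ge>N. f i (zs n) \<in> (\<lambda>u. f i z + u) ` U))"

text \<open>Only the operators \<open>T t\<close> with \<open>t \<ge> 0\<close> belong to the family.\<close>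

definition C0_semigroup :: "'b::real_vector topology \<Rightarrow> (real \<Rightarrow> 'b \<Rightarrow> 'b) \<Rightarrow> bool" where
  "C0_semigroup X T \<longleftrightarrow>
     hausdorff_lcs X \<and>
     (\<forall>t\<ge>0. linear (T t)) \<and>
     T 0 = id \<and>
     (\<forall>t\<ge>0. \<forall>s\<ge>0. T (t + s) = T t \<circ> T s) \<and>
     (\<forall>z. limitin X (\<lambda>t. T t z) z (at_right 0))"

definition C0_seq_equicontinuous_semigroup ::
  "'b::real_vector topology \<Rightarrow> (real \<Rightarrow> 'b \<Rightarrow> 'b) \<Rightarrow> bool" where
  "C0_seq_equicontinuous_semigroup X T \<longleftrightarrow>
     C0_semigroup X T \<and> seq_equicontinuous X {0..} T"

definition C0_seq_locally_equicontinuous_semigroup ::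
  "'b::real_vector topology \<Rightarrow> (real \<Rightarrow> 'b \<Rightarrow> 'b) \<Rightarrow> bool" where
  "C0_seq_locally_equicontinuous_semigroup X T \<longleftrightarrow>
     C0_semigroup X T \<and> (\<forall>R>0. seq_equicontinuous X {0..R} T)"


section \<open>Riemann integrals in a locally convex space\<close>

text \<open>
  Limit of the tagged Riemann sums as the mesh tends to \<open>0\<close>; \<open>measure lborel k\<close>
  is the length of the subinterval \<open>k\<close>.
\<close>

definition has_riemann_integral ::
  "'b::real_vector topology \<Rightarrow> (real \<Rightarrow> 'b) \<Rightarrow> real \<Rightarrow> real \<Rightarrow> 'b \<Rightarrow> bool" where
  "has_riemann_integral X g a b y \<longleftrightarrow>
     (\<forall>U. nbhd0 X U \<longrightarrow>
        (\<exists>d>0. \<forall>D. D tagged_division_of {a..b} \<longrightarrow> (\<forall>(x, k)\<in>D. measure lborel k < d) \<longrightarrow>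
           (\<Sum>(x, k)\<in>D. measure lborel k *\<^sub>R g x) \<in> (\<lambda>u. y + u) ` U))"

definition has_generalized_riemann_integral ::
  "'b::real_vector topology \<Rightarrow> (real \<Rightarrow> 'b) \<Rightarrow> 'b \<Rightarrow> bool" where
  "has_generalized_riemann_integral X g y \<longleftrightarrow>
     (\<exists>G. (\<forall>a\<ge>0. has_riemann_integral X g 0 a (G a)) \<and> limitin X G y at_top)"


section \<open>The transition operators\<close>

text \<open>
  \<open>Bcontfun\<close> is meaningful only on bounded continuous functions; \<open>transition_op_apply\<close> below
  shows that this is the case under the assumptions on \<open>\<mu>\<close>.
\<close>

definition transition_op ::
  "(real \<Rightarrow> 'a::topological_space \<Rightarrow> 'a measure) \<Rightarrow> real \<Rightarrow> ('a \<Rightarrow>\<^sub>C real) \<Rightarrow> ('a \<Rightarrow>\<^sub>C real)" where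
  "transition_op \<mu> t f = Bcontfun (\<lambda>\<xi>. \<integral>x. f x \<partial>\<mu> t \<xi>)"


section \<open>Consistency of the definitions\<close>

lemma variation_measure:
  assumes M: "M \<in> ca_pos" and A: "A \<in> sets borel"
  shows "variation (measure M) A = measure M A"
proof -
  interpret finite_measure M using M by (simp add: ca_pos_def)
  have sets: "sets M = sets borel" using M by (simp add: ca_pos_def)
  have eq: "(\<Sum>B\<in>P. \<bar>measure M B\<bar>) = measure M A"
    if P: "finite P" "disjoint P" "P \<subseteq> sets borel" "\<Union>P = A" for P
  proof -
    have "measure M (\<Union>B\<in>P. B) = (\<Sum>B\<in>P. measure M B)"
      by (rule finite_measure_finite_Union)
        (use P sets in \<open>auto simp: disjoint_family_on_def disjoint_def\<close>)
    then show ?thesis using P by simp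
  qed
  let ?Q = "{P. finite P \<and> disjoint P \<and> P \<subseteq> sets borel \<and> \<Union>P = A}"
  have "{A} \<in> ?Q"
    using A by (auto simp: disjoint_def)
  moreover have "(\<Sum>B\<in>P. \<bar>measure M B\<bar>) = measure M A" if "P \<in> ?Q" for P
    using that eq by blast
  ultimately have "(\<lambda>P. \<Sum>B\<in>P. \<bar>measure M B\<bar>) ` ?Q = {measure M A}"
    by (metis (no_types, lifting) empty_iff image_cong image_constant)
  then show ?thesis by (simp add: variation_def)
qed

lemma ca_norm_measure: "M \<in> ca_pos \<Longrightarrow> ca_norm (measure M) = measure M UNIV"
  by (simp add: ca_norm_def variation_measure)

lemma measure_in_ca:
  assumes "M \<in> ca_pos"
  shows "measure M \<in> ca"
proof -
  interpret finite_measure M using assms by (simp add: ca_pos_def)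
  show ?thesis
    using assms finite_measure_UNION by (auto simp: ca_def ca_pos_def)
qed

lemma ca_integral_measure:
  assumes M: "M \<in> ca_pos"
  shows "ca_integral (measure M) f = (\<integral>x. f x \<partial>M)"
proof -
  interpret finite_measure M using M by (simp add: ca_pos_def)
  have sets: "sets M = sets borel" using M by (simp add: ca_pos_def)
  have sp: "space M = UNIV" using sets_eq_imp_space_eq[OF sets] by simp
  have "pos_part (measure M) = measure_of UNIV (sets borel) (emeasure M)"
    unfolding pos_part_def
    by (rule measure_of_eq)
      (auto simp: variation_measure[OF M] emeasure_eq_measure sets.sigma_sets_eq[of borel, simplified])
  also have "\<dots> = M"
    using measure_of_of_measure[of M] sets sp by simp
  finally have pos: "pos_part (measure M) = M" .
  have "neg_part (measure M) = measure_of UNIV (sets borel) (\<lambda>_. 0)"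
    unfolding neg_part_def
    by (rule measure_of_eq)
      (auto simp: variation_measure[OF M] sets.sigma_sets_eq[of borel, simplified])
  also have "\<dots> = null_measure borel"
    by (rule measure_eqI) (auto simp: emeasure_sigma sets.sigma_sets_eq[of borel, simplified])
  finally have neg: "neg_part (measure M) = null_measure borel" .
  show ?thesis by (simp add: ca_integral_def pos neg)
qed

lemma transition_op_apply:
  fixes f :: "'a::topological_space \<Rightarrow>\<^sub>C real"
  assumes meas: "\<And>\<xi>. \<mu> t \<xi> \<in> ca_pos"
    and bounded: "\<And>\<xi>. ca_norm (measure (\<mu> t \<xi>)) \<le> C"
    and cont: "continuous_on UNIV (\<lambda>\<xi>. \<integral>x. f x \<partial>\<mu> t \<xi>)"
  shows "transition_op \<mu> t f \<xi> = (\<integral>x. f x \<partial>\<mu> t \<xi>)"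
proof -
  obtain b where b: "\<bar>f x\<bar> \<le> b" for x
    using bounded_apply_bcontfun[of f] by (auto simp: bounded_iff)
  have "\<bar>\<integral>x. f x \<partial>\<mu> t \<xi>\<bar> \<le> b * C" for \<xi>
  proof -
    interpret finite_measure "\<mu> t \<xi>" using meas by (simp add: ca_pos_def)
    have sets: "sets (\<mu> t \<xi>) = sets borel" using meas by (simp add: ca_pos_def)
    have sp: "space (\<mu> t \<xi>) = UNIV" using sets_eq_imp_space_eq[OF sets] by simp
    have "apply_bcontfun f \<in> borel_measurable borel"
      by (simp add: borel_measurable_continuous_onI)
    then have "apply_bcontfun f \<in> borel_measurable (\<mu> t \<xi>)"
      using measurable_cong_sets[OF sets refl] by blast
    then have int: "integrable (\<mu> t \<xi>) f"
      by (intro integrable_const_bound[where B = b]) (auto simp: b)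
    have "\<bar>\<integral>x. f x \<partial>\<mu> t \<xi>\<bar> \<le> (\<integral>x. \<bar>f x\<bar> \<partial>\<mu> t \<xi>)"
      by (rule integral_abs_bound)
    also have "\<dots> \<le> (\<integral>x. b \<partial>\<mu> t \<xi>)"
      by (intro integral_mono) (use int b in auto)
    also have "\<dots> = b * measure (\<mu> t \<xi>) UNIV"
      by (simp add: sp)
    also have "\<dots> \<le> b * C"
    proof (rule mult_left_mono)
      show "measure (\<mu> t \<xi>) UNIV \<le> C"
        using bounded[of \<xi>] by (simp add: ca_norm_measure meas)
      show "0 \<le> b" using b[of \<xi>] by linarith
    qed
    finally show ?thesis .
  qed
  then have "(\<lambda>\<xi>. \<integral>x. f x \<partial>\<mu> t \<xi>) \<in> bcontfun"
    using cont by (auto simp: bcontfun_def bounded_iff)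
  then show ?thesis
    by (simp add: transition_op_def Bcontfun_inverse)
qed

end

theory Submission
  imports Defs
begin

text \<open>
  The topology \<open>tau_K\<close> is not metrizable in general, and its seminorms involve all signed measures on
  a space that need not be separable or complete. The proof avoids both difficulties by describing
  the convergent sequences: a sequence converges in \<open>tau_K\<close> if and only if it is bounded in the sup
  norm and converges uniformly on compact sets (\<open>limitin_tau_K_sequentially_iff\<close>). The
  bound is the substantial part. It says that functions whose integrals against every finite
  measure stay bounded are uniformly bounded, and a gliding hump against a
  discrete measure proves this (\<open>norm_bounded_if_integrals_bounded\<close>).

  All assertions of the theorem can be tested along sequences. Sequential equicontinuity of a family
  of operators becomes convergence along arbitrary sequences of indices; limits
  as \<open>t\<close> decreases to \<open>0\<close> or tends to infinity, and limits of Riemann sums as the mesh tends to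
  \<open>0\<close>, become limits of sequences. By the criterion, only a bound and uniform convergence on compact
  sets remain to be shown in each case.

  For the transition operators, the bound is the bound on the total masses. Uniformity on compact
  sets comes from tightness for local equicontinuity (\<open>T_locally_equicontinuous\<close>), and from tightness
  together with the concentration of \<open>\<mu> t \<xi>\<close> near \<open>\<xi>\<close> for small \<open>t\<close> for the continuity at \<open>t = 0\<close>
  (\<open>T_uniformly_near_identity\<close>). With the discount factor \<open>exp (- \<alpha> * t)\<close> late times contribute little,
  so the equicontinuity becomes global (\<open>discounted_T_equicontinuous\<close>). The semigroup law
  and local equicontinuity extend the continuity from \<open>0\<close> to all times (\<open>T_orbit_continuous\<close>).

  A curve that is continuous in this sense has a Riemann integral over bounded intervals, namely the
  pointwise integral (\<open>has_riemann_integral_tau_K\<close>), and exponential decay of the norm gives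
  convergence of these integrals even in the sup norm
  (\<open>has_generalized_riemann_integral_tau_K\<close>).
\<close>

section \<open>Topologies generated by seminorms\<close>

definition is_seminorm :: "('b::real_vector \<Rightarrow> real) \<Rightarrow> bool" where
  "is_seminorm p \<longleftrightarrow>
     (\<forall>x y. p (x + y) \<le> p x + p y) \<and> (\<forall>c x. p (c *\<^sub>R x) = \<bar>c\<bar> * p x)"

lemma seminorm_add: "is_seminorm p \<Longrightarrow> p (x + y) \<le> p x + p y"
  by (simp add: is_seminorm_def)

lemma seminorm_scale: "is_seminorm p \<Longrightarrow> p (c *\<^sub>R x) = \<bar>c\<bar> * p x"
  by (simp add: is_seminorm_def)

lemma seminorm_zero: "is_seminorm p \<Longrightarrow> p 0 = 0"
  using seminorm_scale[of p 0 0] by simp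

lemma seminorm_uminus: "is_seminorm p \<Longrightarrow> p (- x) = p x"
  using seminorm_scale[of p "-1" x] by simp

lemma seminorm_minus_commute: "is_seminorm p \<Longrightarrow> p (x - y) = p (y - x)"
  using seminorm_uminus[of p "x - y"] by simp

lemma seminorm_nonneg: "is_seminorm p \<Longrightarrow> 0 \<le> p x"
  using seminorm_add[of p x "- x"] seminorm_uminus[of p x] seminorm_zero[of p] by simp

lemma seminorm_triangle: "is_seminorm p \<Longrightarrow> p (x - z) \<le> p (x - y) + p (y - z)"
  using seminorm_add[of p "x - y" "y - z"] by simp

context
  fixes P :: "('b::real_vector \<Rightarrow> real) set"
  assumes P: "P \<noteq> {}" "\<And>p. p \<in> P \<Longrightarrow> is_seminorm p"
begin

text \<open>The neighbourhoods of \<open>x\<close> are governed by finitely many seminorms and balls centred at \<open>x\<close>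
  itself, although the subbasic sets that generate the topology may be centred elsewhere: the
  triangle inequality recentres them.\<close>

lemma openin_seminorm_topology_iff:
  "openin (seminorm_topology P) U \<longleftrightarrow>
    (\<forall>x\<in>U. \<exists>F e. finite F \<and> F \<subseteq> P \<and> e > 0 \<and> (\<forall>y. (\<forall>p\<in>F. p (y - x) < e) \<longrightarrow> y \<in> U))"
    (is "_ \<longleftrightarrow> ?nb U")
proof
  let ?S = "{{y. p (y - x) < e} |p x e. p \<in> P \<and> e > 0}"
  assume "openin (seminorm_topology P) U"
  then have "generate_topology_on ?S U"
    by (simp add: seminorm_topology_def openin_topology_generated_by_iff)
  then show "?nb U"
  proof induction
    case Empty
    then show ?case by simp
  next
    case (Int a b)
    show ?case
    proof
      fix x assume x: "x \<in> a \<inter> b"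
      obtain F e where 1: "finite F" "F \<subseteq> P" "e > 0" "\<And>y. (\<forall>p\<in>F. p (y - x) < e) \<Longrightarrow> y \<in> a"
        using bspec[OF Int.IH(1) IntD1[OF x]] by blast
      obtain F' e' where 2: "finite F'" "F' \<subseteq> P" "e' > 0" "\<And>y. (\<forall>p\<in>F'. p (y - x) < e') \<Longrightarrow> y \<in> b"
        using bspec[OF Int.IH(2) IntD2[OF x]] by blast
      show "\<exists>F e. finite F \<and> F \<subseteq> P \<and> e > 0 \<and> (\<forall>y. (\<forall>p\<in>F. p (y - x) < e) \<longrightarrow> y \<in> a \<inter> b)"
      proof (intro exI[of _ "F \<union> F'"] exI[of _ "min e e'"] conjI allI impI IntI)
        fix y assume y: "\<forall>p\<in>F \<union> F'. p (y - x) < min e e'"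
        show "y \<in> a" by (rule 1(4)) (use y in simp)
        show "y \<in> b" by (rule 2(4)) (use y in simp)
      qed (use 1 2 in simp_all)
    qed
  next
    case (UN K)
    show ?case
    proof
      fix x assume "x \<in> \<Union>K"
      then obtain k where k: "k \<in> K" "x \<in> k" by blast
      show "\<exists>F e. finite F \<and> F \<subseteq> P \<and> e > 0 \<and> (\<forall>y. (\<forall>p\<in>F. p (y - x) < e) \<longrightarrow> y \<in> \<Union>K)"
      proof -
        obtain F e where 1: "finite F" "F \<subseteq> P" "e > 0" "\<And>y. (\<forall>p\<in>F. p (y - x) < e) \<Longrightarrow> y \<in> k"
          using bspec[OF UN.IH[OF k(1)] k(2)] by blast
        then show ?thesis
          using k(1) by (intro exI[of _ F] exI[of _ e]) blast
      qed
    qed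
  next
    case (Basis s)
    then obtain p z e where s: "s = {y. p (y - z) < e}" "p \<in> P" "e > 0" by blast
    show ?case
    proof
      fix x assume x: "x \<in> s"
      have "y \<in> s" if "p (y - x) < e - p (x - z)" for y
        using seminorm_triangle[of p y z x] P(2)[OF s(2)] that s by simp
      then show "\<exists>F e. finite F \<and> F \<subseteq> P \<and> e > 0 \<and> (\<forall>y. (\<forall>p\<in>F. p (y - x) < e) \<longrightarrow> y \<in> s)"
        by (intro exI[of _ "{p}"] exI[of _ "e - p (x - z)"]) (use s x in auto)
    qed
  qed
next
  assume U: "?nb U"
  obtain q where q: "q \<in> P" using P(1) by blast
  have opn: "openin (seminorm_topology P) {y. p (y - x) < e}" if "p \<in> P" "e > 0" for p x e
    unfolding seminorm_topology_def
    by (rule topology_generated_by_Basis) (use that in blast)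
  have ball: "openin (seminorm_topology P) {y. \<forall>p\<in>F. p (y - x) < e}"
    if "finite F" "F \<subseteq> P" "e > 0" for F x and e :: real
    using that
  proof (induction F)
    case empty
    have "y \<in> {y'. q (y' - y) < 1}" for y
      by (simp add: seminorm_zero[OF P(2)[OF q]])
    then have "UNIV = (\<Union>x. {y. q (y - x) < 1})"
      by blast
    also have "openin (seminorm_topology P) \<dots>"
      using opn[OF q, of 1] by (intro openin_Union) auto
    finally show ?case by simp
  next
    case (insert p F)
    have "{y. \<forall>p\<in>insert p F. p (y - x) < e} = {y. p (y - x) < e} \<inter> {y. \<forall>p\<in>F. p (y - x) < e}"
      by auto
    then show ?case using insert opn by (simp add: openin_Int)
  qed
  show "openin (seminorm_topology P) U"
  proof (subst openin_subopen, intro ballI)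
    fix x assume "x \<in> U"
    from bspec[OF U this]
    obtain F e where F: "finite F" "F \<subseteq> P" "e > 0" "\<And>y. (\<forall>p\<in>F. p (y - x) < e) \<Longrightarrow> y \<in> U"
      by blast
    show "\<exists>T. openin (seminorm_topology P) T \<and> x \<in> T \<and> T \<subseteq> U"
    proof (intro exI[of _ "{y. \<forall>p\<in>F. p (y - x) < e}"] conjI)
      show "openin (seminorm_topology P) {y. \<forall>p\<in>F. p (y - x) < e}" using F by (intro ball)
      show "x \<in> {y. \<forall>p\<in>F. p (y - x) < e}"
        using F P(2) by (auto simp: subset_iff seminorm_zero)
      show "{y. \<forall>p\<in>F. p (y - x) < e} \<subseteq> U" using F by auto
    qed
  qed
qed

lemma openin_seminorm_topologyE:
  assumes "openin (seminorm_topology P) U" "x \<in> U"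
  obtains F e where "finite F" "F \<subseteq> P" "e > 0" "\<forall>y. (\<forall>p\<in>F. p (y - x) < e) \<longrightarrow> y \<in> U"
proof -
  from bspec[OF assms(1)[unfolded openin_seminorm_topology_iff] assms(2)]
  obtain F e where "finite F" "F \<subseteq> P" "e > 0" "\<forall>y. (\<forall>p\<in>F. p (y - x) < e) \<longrightarrow> y \<in> U"
    by blast
  then show thesis by (intro that[of F e])
qed

lemma zero_mem_seminorm_ball:
  assumes "F \<subseteq> P" "e > 0"
  shows "0 \<in> {y. \<forall>p\<in>F. p y < e}"
proof -
  have "p 0 < e" if "p \<in> F" for p
    using seminorm_zero[of p] P(2)[of p] that assms by auto
  then show ?thesis by blast
qed

lemma topspace_seminorm_topology: "topspace (seminorm_topology P) = UNIV"
proof -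
  have "openin (seminorm_topology P) UNIV"
    unfolding openin_seminorm_topology_iff
    by (auto intro!: exI[of _ "{}"] exI[of _ "1::real"])
  then show ?thesis
    using openin_subset by blast
qed

lemma openin_seminorm_ball:
  assumes "finite F" "F \<subseteq> P" "e > 0"
  shows "openin (seminorm_topology P) {y. \<forall>p\<in>F. p (y - x) < e}"
  unfolding openin_seminorm_topology_iff
proof
  fix z assume z: "z \<in> {y. \<forall>p\<in>F. p (y - x) < e}"
  define d where "d = Min (insert e ((\<lambda>p. e - p (z - x)) ` F))"
  have d: "d > 0" using assms z by (auto simp: d_def)
  have d': "d \<le> e - p (z - x)" if "p \<in> F" for p
    using assms that by (auto simp: d_def)
  have "p (y - x) < e" if "p \<in> F" "p (y - z) < d" for p y
    using seminorm_triangle[OF P(2), of p y x z] assms(2) that d'[of p] by (auto simp: subset_iff)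
  then show "\<exists>F' e'. finite F' \<and> F' \<subseteq> P \<and> 0 < e' \<and>
      (\<forall>y. (\<forall>p\<in>F'. p (y - z) < e') \<longrightarrow> y \<in> {y. \<forall>p\<in>F. p (y - x) < e})"
    by (intro exI[of _ F] exI[of _ d]) (use assms d in auto)
qed

lemma openin_seminorm_ball_single:
  assumes "p \<in> P" "e > 0"
  shows "openin (seminorm_topology P) {y. p (y - x) < e}"
  using openin_seminorm_ball[of "{p}" e x] assms by simp

lemma limitin_seminorm_topology_iff:
  "limitin (seminorm_topology P) f l G \<longleftrightarrow> (\<forall>p\<in>P. ((\<lambda>n. p (f n - l)) \<longlongrightarrow> 0) G)"
proof
  assume L: "limitin (seminorm_topology P) f l G"
  show "\<forall>p\<in>P. ((\<lambda>n. p (f n - l)) \<longlongrightarrow> 0) G"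
  proof (intro ballI tendstoI)
    fix p and e :: real assume p: "p \<in> P" and e: "e > 0"
    have "eventually (\<lambda>n. f n \<in> {y. p (y - l) < e}) G"
      using L openin_seminorm_ball_single[OF p e, of l] seminorm_zero[OF P(2)[OF p]] e
      unfolding limitin_def by (auto dest: spec[of _ "{y. p (y - l) < e}"])
    then show "eventually (\<lambda>n. dist (p (f n - l)) 0 < e) G"
      by eventually_elim (simp add: seminorm_nonneg[OF P(2)[OF p]])
  qed
next
  assume L: "\<forall>p\<in>P. ((\<lambda>n. p (f n - l)) \<longlongrightarrow> 0) G"
  show "limitin (seminorm_topology P) f l G"
    unfolding limitin_def
  proof (intro conjI allI impI)
    show "l \<in> topspace (seminorm_topology P)" by (simp add: topspace_seminorm_topology)
    fix U assume U: "openin (seminorm_topology P) U \<and> l \<in> U"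
    obtain F e where F: "finite F" "F \<subseteq> P" "e > 0" "\<forall>y. (\<forall>p\<in>F. p (y - l) < e) \<longrightarrow> y \<in> U"
      using openin_seminorm_topologyE[OF conjunct1[OF U] conjunct2[OF U]] .
    have "eventually (\<lambda>n. p (f n - l) < e) G" if "p \<in> F" for p
      using L F that by (auto intro: order_tendstoD)
    then have "eventually (\<lambda>n. \<forall>p\<in>F. p (f n - l) < e) G"
      using F(1) by (simp add: eventually_ball_finite)
    then show "eventually (\<lambda>n. f n \<in> U) G"
      by eventually_elim (use F(4) in blast)
  qed
qed

lemma hausdorff_lcs_seminorm_topology:
  assumes sep: "\<And>x. x \<noteq> 0 \<Longrightarrow> \<exists>p\<in>P. p x \<noteq> 0"
  shows "hausdorff_lcs (seminorm_topology P)"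
  unfolding hausdorff_lcs_def
proof (intro conjI allI impI)
  let ?X = "seminorm_topology P"
  let ?S = "{{y. p (y - x) < e} |p x e. p \<in> P \<and> e > 0}"
  have S: "\<Union>?S = UNIV"
    using topspace_seminorm_topology
    by (simp add: seminorm_topology_def topology_generated_by_topspace)
  show "topspace ?X = UNIV" by (rule topspace_seminorm_topology)
  show "continuous_map (prod_topology ?X ?X) ?X (\<lambda>(x, y). x + y)"
    unfolding seminorm_topology_def[of P] continuous_on_generated_topo_iff S
    unfolding seminorm_topology_def[of P, symmetric]
  proof (intro conjI allI impI subset_UNIV)
    fix U assume "U \<in> ?S"
    then obtain p z e where U: "U = {y. p (y - z) < e}" and p: "p \<in> P" and e: "e > 0" by blast
    note sn = P(2)[OF p]
    show "openin (prod_topology ?X ?X) ((\<lambda>(x, y). x + y) -` U \<inter> topspace (prod_topology ?X ?X))"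
      unfolding openin_prod_topology_alt
    proof (intro allI impI)
      fix a b assume "(a, b) \<in> (\<lambda>(x, y). x + y) -` U \<inter> topspace (prod_topology ?X ?X)"
      then have ab: "p (a + b - z) < e" using U by simp
      define r where "r = (e - p (a + b - z)) / 2"
      have r: "r > 0" using ab by (simp add: r_def)
      have "p (c + d - z) < e" if "p (c - a) < r" "p (d - b) < r" for c d
      proof -
        have "p (c + d - z) \<le> p ((c - a) + (d - b)) + p (a + b - z)"
          using seminorm_add[OF sn, of "(c - a) + (d - b)" "a + b - z"] by (simp add: algebra_simps)
        then show ?thesis
          using seminorm_add[OF sn, of "c - a" "d - b"] that by (simp add: r_def)
      qed
      then show "\<exists>A B. openin ?X A \<and> openin ?X B \<and> a \<in> A \<and> b \<in> B \<and>
          A \<times> B \<subseteq> (\<lambda>(x, y). x + y) -` U \<inter> topspace (prod_topology ?X ?X)"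
        using openin_seminorm_ball_single[OF p r] seminorm_zero[OF sn] r U
        by (intro exI[of _ "{y. p (y - a) < r}"] exI[of _ "{y. p (y - b) < r}"])
           (auto simp: topspace_seminorm_topology)
    qed
  qed
  show "continuous_map (prod_topology euclideanreal ?X) ?X (\<lambda>(c, x). c *\<^sub>R x)"
    unfolding seminorm_topology_def[of P] continuous_on_generated_topo_iff S
    unfolding seminorm_topology_def[of P, symmetric]
  proof (intro conjI allI impI subset_UNIV)
    fix U assume "U \<in> ?S"
    then obtain p z e where U: "U = {y. p (y - z) < e}" and p: "p \<in> P" and e: "e > 0" by blast
    note sn = P(2)[OF p]
    show "openin (prod_topology euclideanreal ?X)
        ((\<lambda>(c, x). c *\<^sub>R x) -` U \<inter> topspace (prod_topology euclideanreal ?X))"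
      unfolding openin_prod_topology_alt
    proof (intro allI impI)
      fix c a assume "(c, a) \<in> (\<lambda>(c, x). c *\<^sub>R x) -` U \<inter> topspace (prod_topology euclideanreal ?X)"
      then have ca: "p (c *\<^sub>R a - z) < e" using U by simp
      define r where "r = (e - p (c *\<^sub>R a - z)) / 2"
      define r1 where "r1 = r / (p a + 1)"
      define r2 where "r2 = min 1 (r / (\<bar>c\<bar> + 1))"
      have pa: "p a \<ge> 0" by (rule seminorm_nonneg[OF sn])
      have r: "r > 0" using ca by (simp add: r_def)
      have r1: "r1 > 0" and r2: "r2 > 0" using r pa by (auto simp: r1_def r2_def)
      have "p (d *\<^sub>R y - z) < e" if d: "\<bar>d - c\<bar> < r1" and y: "p (y - a) < r2" for d y
      proof -
        have split: "d *\<^sub>R y - z = ((d - c) *\<^sub>R y + c *\<^sub>R (y - a)) + (c *\<^sub>R a - z)"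
          by (simp add: algebra_simps)
        have "p (d *\<^sub>R y - z) \<le> p ((d - c) *\<^sub>R y + c *\<^sub>R (y - a)) + p (c *\<^sub>R a - z)"
          unfolding split by (rule seminorm_add[OF sn])
        also have "p ((d - c) *\<^sub>R y + c *\<^sub>R (y - a)) \<le> \<bar>d - c\<bar> * p y + \<bar>c\<bar> * p (y - a)"
          using seminorm_add[OF sn, of "(d - c) *\<^sub>R y" "c *\<^sub>R (y - a)"] by (simp add: seminorm_scale[OF sn])
        also have "\<bar>d - c\<bar> * p y < r"
        proof -
          have "p y \<le> p a + 1"
            using seminorm_add[OF sn, of "y - a" a] y by (simp add: r2_def)
          then have "\<bar>d - c\<bar> * p y \<le> \<bar>d - c\<bar> * (p a + 1)" by (simp add: mult_left_mono)
          also have "\<dots> < r1 * (p a + 1)" using d pa by (intro mult_strict_right_mono) auto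
          also have "\<dots> = r" using pa by (simp add: r1_def)
          finally show ?thesis .
        qed
        also have "\<bar>c\<bar> * p (y - a) \<le> r"
        proof -
          have "\<bar>c\<bar> * p (y - a) \<le> \<bar>c\<bar> * (r / (\<bar>c\<bar> + 1))"
            using y by (intro mult_left_mono) (auto simp: r2_def)
          also have "\<dots> \<le> r" using r by (simp add: field_simps)
          finally show ?thesis .
        qed
        finally show ?thesis by (simp add: r_def)
      qed
      then show "\<exists>A B. openin euclideanreal A \<and> openin ?X B \<and> c \<in> A \<and> a \<in> B \<and>
          A \<times> B \<subseteq> (\<lambda>(c, x). c *\<^sub>R x) -` U \<inter> topspace (prod_topology euclideanreal ?X)"
        using openin_seminorm_ball_single[OF p r2] seminorm_zero[OF sn] r1 r2 U
        by (intro exI[of _ "ball c r1"] exI[of _ "{y. p (y - a) < r2}"])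
           (auto simp: topspace_seminorm_topology dist_real_def abs_minus_commute)
    qed
  qed
  show "Hausdorff_space ?X"
    unfolding Hausdorff_space_def
  proof (intro allI impI)
    fix x y assume "x \<in> topspace ?X \<and> y \<in> topspace ?X \<and> x \<noteq> y"
    then obtain p where p: "p \<in> P" "p (x - y) \<noteq> 0" using sep[of "x - y"] by auto
    note sn = P(2)[OF p(1)]
    define r where "r = p (x - y) / 2"
    have r: "r > 0" using p seminorm_nonneg[OF sn, of "x - y"] by (simp add: r_def)
    have False if "p (z - x) < r" "p (z - y) < r" for z
      using that seminorm_triangle[OF sn, of x y z] seminorm_minus_commute[OF sn, of x z]
      by (simp add: r_def)
    then show "\<exists>U V. openin ?X U \<and> openin ?X V \<and> x \<in> U \<and> y \<in> V \<and> disjnt U V"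
      using openin_seminorm_ball_single[OF p(1) r] seminorm_zero[OF sn] r
      by (intro exI[of _ "{z. p (z - x) < r}"] exI[of _ "{z. p (z - y) < r}"])
         (auto simp: disjnt_def)
  qed
  fix U assume U: "openin ?X U" "0 \<in> U"
  obtain F e where F: "finite F" "F \<subseteq> P" "e > 0" "\<forall>y. (\<forall>p\<in>F. p (y - 0) < e) \<longrightarrow> y \<in> U"
    using openin_seminorm_topologyE[OF U] .
  have sub: "{y. \<forall>p\<in>F. p y < e} \<subseteq> U"
    using F(4) by (intro subsetI) simp
  have "convex {y. \<forall>p\<in>F. p y < e}"
  proof (rule convexI)
    fix x y :: 'b and u v :: real
    assume xy: "x \<in> {y. \<forall>p\<in>F. p y < e}" "y \<in> {y. \<forall>p\<in>F. p y < e}" and uv: "0 \<le> u" "0 \<le> v" "u + v = 1"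
    have "p (u *\<^sub>R x + v *\<^sub>R y) < e" if p: "p \<in> F" for p
    proof -
      have sn: "is_seminorm p" using p F P(2) by blast
      have "p (u *\<^sub>R x + v *\<^sub>R y) \<le> u * p x + v * p y"
        using seminorm_add[OF sn, of "u *\<^sub>R x" "v *\<^sub>R y"] uv by (simp add: seminorm_scale[OF sn])
      also have "\<dots> < e"
        using xy p uv by (intro convex_bound_lt) auto
      finally show ?thesis .
    qed
    then show "u *\<^sub>R x + v *\<^sub>R y \<in> {y. \<forall>p\<in>F. p y < e}" by simp
  qed
  moreover have "0 \<in> {y. \<forall>p\<in>F. p y < e}"
    using F(2,3) by (rule zero_mem_seminorm_ball)
  ultimately show "\<exists>V. openin ?X V \<and> 0 \<in> V \<and> convex V \<and> V \<subseteq> U"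
    using openin_seminorm_ball[OF F(1,2,3), of 0] sub
    by (intro exI[of _ "{y. \<forall>p\<in>F. p y < e}"]) simp
qed

end

section \<open>Testing sequential equicontinuity\<close>

text \<open>Uniformity over the index set costs nothing: a failure at infinitely many times \<open>n\<close> selects a
  sequence of bad indices \<open>i n\<close>, along which the stated convergence would fail. For an arbitrary
  sequence of indices, convergence is the form in which dominated convergence can be used below.\<close>

lemma seq_equicontinuousI:
  assumes "\<And>i zs z. (\<And>n. i n \<in> I) \<Longrightarrow> limitin X zs z sequentially \<Longrightarrow>
      limitin X (\<lambda>n. f (i n) (zs n) - f (i n) z) 0 sequentially"
  shows "seq_equicontinuous X I f"
  unfolding seq_equicontinuous_def
proof (intro allI impI)
  fix zs z U assume lim: "limitin X zs z sequentially" and "nbhd0 X U"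
  then obtain V where V: "openin X V" "0 \<in> V" "V \<subseteq> U" by (auto simp: nbhd0_def)
  have mem: "a \<in> (\<lambda>u. b + u) ` U" if "a - b \<in> V" for a b
    using that V by (intro image_eqI[of _ _ "a - b"]) auto
  show "\<exists>N. \<forall>i\<in>I. \<forall>n\<ge>N. f i (zs n) \<in> (\<lambda>u. f i z + u) ` U"
  proof (cases "I = {}")
    case False
    \<comment> \<open>an index that violates the claim at time \<open>n\<close>, whenever there is one\<close>
    define i where
      "i n = (if \<exists>i\<in>I. f i (zs n) - f i z \<notin> V then SOME i. i \<in> I \<and> f i (zs n) - f i z \<notin> V
              else SOME i. i \<in> I)" for n
    have i: "i n \<in> I \<and> ((\<exists>i\<in>I. f i (zs n) - f i z \<notin> V) \<longrightarrow> f (i n) (zs n) - f (i n) z \<notin> V)" for n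
    proof (cases "\<exists>i\<in>I. f i (zs n) - f i z \<notin> V")
      case True
      then have "\<exists>i. i \<in> I \<and> f i (zs n) - f i z \<notin> V" by blast
      from someI_ex[OF this] True show ?thesis by (simp add: i_def)
    next
      case c: False
      have "\<exists>i. i \<in> I" using False by blast
      from someI_ex[OF this] c show ?thesis by (simp add: i_def)
    qed
    then have "limitin X (\<lambda>n. f (i n) (zs n) - f (i n) z) 0 sequentially"
      by (intro assms lim) blast
    then have "eventually (\<lambda>n. f (i n) (zs n) - f (i n) z \<in> V) sequentially"
      using V by (simp add: limitin_def)
    then obtain N where "\<And>n. n \<ge> N \<Longrightarrow> f (i n) (zs n) - f (i n) z \<in> V"
      by (auto simp: eventually_sequentially)
    then show ?thesis using i mem by blast
  qed simp
qed

section \<open>A uniform boundedness principle by a gliding hump\<close>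

text \<open>The coefficients are chosen one after the other. When \<open>c k\<close> is chosen, the partial sum up to
  \<open>k - 1\<close> is some number \<open>S\<close>, and \<open>S\<close> and \<open>S + w k * a k k\<close> cannot both be smaller in absolute value
  than half the distance between them. Choosing between \<open>0\<close> and \<open>w k\<close>, rather than between the two
  signs, keeps the coefficients nonnegative, so that they define a positive measure.\<close>

lemma gliding_hump_coefficients:
  fixes a :: "nat \<Rightarrow> nat \<Rightarrow> real"
  assumes w: "\<And>k. 0 \<le> w k"
  shows "\<exists>c. \<forall>k. 0 \<le> c k \<and> c k \<le> w k \<and> w k * \<bar>a k k\<bar> / 2 \<le> \<bar>\<Sum>j\<le>k. c j * a k j\<bar>"
proof -
  define Q where "Q c k r \<longleftrightarrow> (r = 0 \<or> r = w k) \<and>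
      w k * \<bar>a k k\<bar> / 2 \<le> \<bar>(\<Sum>j<k. c j * a k j) + r * a k k\<bar>" for c :: "nat \<Rightarrow> real" and k r
  have "\<exists>c. \<forall>k. Q c k (c k)"
  proof (rule dependent_wellorder_choice)
    fix r :: real and f g :: "nat \<Rightarrow> real" and x :: nat
    assume "\<And>y. y < x \<Longrightarrow> f y = g y"
    then have "(\<Sum>j<x. f j * a x j) = (\<Sum>j<x. g j * a x j)"
      by (intro sum.cong) auto
    then show "Q f x r = Q g x r" by (simp add: Q_def)
  next
    fix x :: nat and f :: "nat \<Rightarrow> real"
    have "\<bar>w x * a x x\<bar> = w x * \<bar>a x x\<bar>" using w[of x] by (simp add: abs_mult)
    then have "Q f x 0 \<or> Q f x (w x)"
      unfolding Q_def by (simp split: abs_split) linarith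
    then show "\<exists>r. Q f x r" by blast
  qed
  then obtain c where c: "\<And>k. Q c k (c k)" by blast
  have "c k = 0 \<or> c k = w k" for k using c[of k] by (simp add: Q_def)
  then have "0 \<le> c k" "c k \<le> w k" for k using w[of k] by (metis order_refl)+
  moreover have "w k * \<bar>a k k\<bar> / 2 \<le> \<bar>\<Sum>j\<le>k. c j * a k j\<bar>" for k
    using c[of k] by (simp add: Q_def lessThan_Suc_atMost[symmetric] add.commute)
  ultimately show ?thesis by blast
qed

lemma ca_pos_finite: "M \<in> ca_pos \<Longrightarrow> finite_measure M"
  and ca_pos_sets: "M \<in> ca_pos \<Longrightarrow> sets M = sets borel"
  by (simp_all add: ca_pos_def)

lemma ca_pos_space: "M \<in> ca_pos \<Longrightarrow> space M = UNIV"
  using sets_eq_imp_space_eq[OF ca_pos_sets] by simp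

lemma ca_pos_measurable:
  fixes f :: "'a::topological_space \<Rightarrow>\<^sub>C real"
  assumes "M \<in> ca_pos"
  shows "apply_bcontfun f \<in> borel_measurable M"
  using measurable_cong_sets[OF ca_pos_sets[OF assms] refl]
    borel_measurable_continuous_onI[of "apply_bcontfun f"] by auto

lemma abs_apply_bcontfun_le: "\<bar>apply_bcontfun f x\<bar> \<le> norm f"
  for f :: "'a::topological_space \<Rightarrow>\<^sub>C real"
  using norm_bounded[of f x] by simp

lemma ca_pos_integrable:
  fixes f :: "'a::topological_space \<Rightarrow>\<^sub>C real"
  assumes "M \<in> ca_pos"
  shows "integrable M f"
proof -
  interpret finite_measure M by (rule ca_pos_finite[OF assms])
  show ?thesis
    by (rule integrable_const_bound[where B = "norm f"])
       (auto simp: ca_pos_measurable[OF assms] abs_apply_bcontfun_le)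
qed

text \<open>A sum of point masses, realised as the image under \<open>x\<close> of a weighted counting measure, so that
  integrals against it become series by a change of variables.\<close>

lemma discrete_measure:
  fixes x :: "nat \<Rightarrow> 'a::topological_space"
  assumes c: "\<And>j. 0 \<le> c j" "summable c"
  shows "\<exists>M\<in>ca_pos. \<forall>f :: 'a \<Rightarrow>\<^sub>C real. (\<lambda>j. c j * f (x j)) sums (\<integral>y. f y \<partial>M)"
proof -
  define D where "D = density (count_space UNIV) (\<lambda>j. ennreal (c j))"
  define M where "M = distr D borel x"
  have x: "x \<in> measurable D borel" by (simp add: D_def)
  have "emeasure D UNIV = (\<Sum>j. ennreal (c j))"
    by (simp add: D_def emeasure_density nn_integral_count_space_nat)
  also have "\<dots> \<noteq> top"
    using c by (simp add: ennreal_suminf_neq_top)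
  finally have fin: "emeasure D UNIV \<noteq> top" .
  interpret D: finite_measure D
    by (rule finite_measureI) (use fin in \<open>simp add: D_def\<close>)
  have M: "M \<in> ca_pos"
    unfolding ca_pos_def M_def using D.finite_measure_distr[OF x] by simp
  have "(\<lambda>j. c j * f (x j)) sums (\<integral>y. f y \<partial>M)" for f :: "'a \<Rightarrow>\<^sub>C real"
  proof -
    have f: "apply_bcontfun f \<in> borel_measurable borel"
      by (simp add: borel_measurable_continuous_onI)
    have "(\<integral>y. f y \<partial>M) = (\<integral>j. f (x j) \<partial>D)"
      unfolding M_def by (rule integral_distr[OF x f])
    also have "\<dots> = (\<integral>j. c j *\<^sub>R f (x j) \<partial>count_space UNIV)"
      unfolding D_def by (rule integral_density) (use c in auto)
    finally have eq: "(\<integral>y. f y \<partial>M) = (\<integral>j. c j *\<^sub>R f (x j) \<partial>count_space UNIV)" .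
    have "integrable (count_space UNIV) (\<lambda>j. c j *\<^sub>R f (x j))"
      unfolding integrable_count_space_nat_iff
    proof (rule summable_comparison_test')
      show "summable (\<lambda>j. c j * norm f)" using c(2) by (rule summable_mult2)
      show "norm (norm (c j *\<^sub>R f (x j))) \<le> c j * norm f" for j
        using c(1)[of j] abs_apply_bcontfun_le[of f "x j"] by (simp add: abs_mult mult_left_mono)
    qed
    from sums_integral_count_space_nat[OF this] show ?thesis by (simp add: eq)
  qed
  with M show ?thesis by blast
qed

text \<open>If the norms were unbounded, one could choose functions \<open>F k\<close> of the sequence with norm above
  \<open>6 ^ k\<close> and points \<open>x k\<close> at which \<open>F k\<close> nearly attains its norm, and test them against a
  measure with mass at most \<open>5 ^ - k\<close> at \<open>x k\<close>. The gliding hump coefficients prevent the atoms before \<open>k\<close> from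
  cancelling the one at \<open>k\<close>, and the atoms after \<open>k\<close> are too light to do so; hence the absolute value of the
  integral of \<open>F k\<close> is at least a constant times \<open>(6/5) ^ k\<close>.\<close>

lemma norm_bounded_if_integrals_bounded:
  fixes fs :: "nat \<Rightarrow> 'a::topological_space \<Rightarrow>\<^sub>C real"
  assumes "\<And>M. M \<in> ca_pos \<Longrightarrow> \<exists>B. \<forall>n. \<bar>\<integral>x. fs n x \<partial>M\<bar> \<le> B"
  shows "\<exists>B. \<forall>n. norm (fs n) \<le> B"
proof (rule ccontr)
  assume "\<not> ?thesis"
  then have "\<forall>k. \<exists>n. norm (fs n) > 6 ^ k" by (meson not_less)
  then obtain N where N: "\<And>k. norm (fs (N k)) > 6 ^ k" by metis
  define F where "F k = fs (N k)" for k
  have F: "norm (F k) > 6 ^ k" for k by (simp add: F_def N)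
  have Fpos: "norm (F k) > 0" for k by (rule less_trans[OF _ F]) simp
  have "\<exists>x. \<bar>F k x\<bar> \<ge> 3/4 * norm (F k)" for k
  proof (rule ccontr)
    assume "\<not> ?thesis"
    then have "norm (F k) \<le> 3/4 * norm (F k)"
      by (intro norm_bound) (auto simp: not_le intro: less_imp_le)
    then show False using Fpos[of k] by simp
  qed
  then obtain x where x: "\<And>k. \<bar>F k (x k)\<bar> \<ge> 3/4 * norm (F k)" by metis
  define w :: "nat \<Rightarrow> real" where "w k = (1/5) ^ k" for k
  have w: "0 \<le> w k" for k by (simp add: w_def)
  obtain c where c: "\<And>k. 0 \<le> c k" "\<And>k. c k \<le> w k"
    "\<And>k. w k * \<bar>F k (x k)\<bar> / 2 \<le> \<bar>\<Sum>j\<le>k. c j * F k (x j)\<bar>"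
    using gliding_hump_coefficients[where w = w and a = "\<lambda>k j. F k (x j)", OF w] by metis
  have "summable w" unfolding w_def by (rule summable_geometric) simp
  then have "summable c"
    by (rule summable_comparison_test'[where g = w]) (use c in auto)
  then obtain M where M: "M \<in> ca_pos"
    "\<And>f :: 'a \<Rightarrow>\<^sub>C real. (\<lambda>j. c j * f (x j)) sums (\<integral>y. f y \<partial>M)"
    using discrete_measure[of c x] c(1) by metis
  obtain B where B: "\<And>n. \<bar>\<integral>x. fs n x \<partial>M\<bar> \<le> B" using assms[OF M(1)] by blast
  have low: "(6/5) ^ k / 8 \<le> B" for k
  proof -
    let ?I = "\<integral>x. F k x \<partial>M" and ?S = "\<Sum>j\<le>k. c j * F k (x j)"
    \<comment> \<open>the weights after the \<open>k\<close>-th add up to \<open>w k / 4\<close>, too little to cancel the \<open>k\<close>-th hump\<close>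
    have "(\<lambda>j. w (Suc k) * (1/5) ^ j) sums (w (Suc k) * (1 / (1 - 1/5)))"
      by (intro sums_mult geometric_sums) simp
    then have "(\<lambda>j. norm (F k) * w (j + Suc k)) sums (norm (F k) * (w k / 4))"
      by (intro sums_mult) (simp add: w_def power_add mult.commute)
    moreover have "(\<lambda>j. c (j + Suc k) * F k (x (j + Suc k))) sums (?I - ?S)"
      using sums_split_initial_segment[OF M(2)[of "F k"], of "Suc k"]
      by (simp add: lessThan_Suc_atMost)
    moreover have "norm (c (j + Suc k) * F k (x (j + Suc k))) \<le> norm (F k) * w (j + Suc k)" for j
    proof -
      have "norm (c (j + Suc k) * F k (x (j + Suc k))) = c (j + Suc k) * \<bar>F k (x (j + Suc k))\<bar>"
        using c(1) by (simp add: abs_mult)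
      also have "\<dots> \<le> w (j + Suc k) * norm (F k)"
        by (intro mult_mono c abs_apply_bcontfun_le w) simp
      finally show ?thesis by (simp add: mult.commute)
    qed
    ultimately have tail: "\<bar>?I - ?S\<bar> \<le> norm (F k) * (w k / 4)"
      using norm_sums_le by fastforce
    have "w k * (3/4 * norm (F k)) / 2 \<le> w k * \<bar>F k (x k)\<bar> / 2"
      using x[of k] w[of k] by (intro divide_right_mono mult_left_mono) auto
    also have "\<dots> \<le> \<bar>?S\<bar>" by (rule c(3))
    also have "\<dots> \<le> \<bar>?I\<bar> + norm (F k) * (w k / 4)" using tail by linarith
    finally have "w k * norm (F k) / 8 \<le> \<bar>?I\<bar>" by (simp add: algebra_simps)
    moreover have "w k * 6 ^ k \<le> w k * norm (F k)"
      using F[of k] w[of k] by (intro mult_left_mono) auto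
    moreover have "w k * 6 ^ k = (6/5) ^ k" by (simp add: w_def power_divide)
    ultimately show ?thesis using B[of "N k"] by (simp add: F_def)
  qed
  obtain k where "8 * B < (6/5) ^ k" using real_arch_pow[of "6/5" "8 * B"] by auto
  with low[of k] show False by simp
qed

section \<open>Sequential convergence against compact sets and measures\<close>

text \<open>For every set function \<open>g\<close>, whether or not it is countably additive: \<open>measure_of\<close> returns the zero
  measure when \<open>g\<close> does not define a measure. This makes the positive and negative part of
  every \<open>\<nu>\<close> a finite Borel measure.\<close>

lemma measure_of_in_ca_pos:
  "measure_of UNIV (sets (borel :: 'a::topological_space measure)) (\<lambda>A. ennreal (g A)) \<in> ca_pos"
proof -
  let ?M = "measure_of UNIV (sets (borel :: 'a measure)) (\<lambda>A. ennreal (g A))"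
  have "finite_measure ?M"
    by (rule finite_measureI) (simp add: emeasure_measure_of_conv)
  moreover have "sets ?M = sets borel"
    using sets.sigma_sets_eq[of "borel :: 'a measure"] by (simp add: sets_measure_of_conv)
  ultimately show ?thesis by (simp add: ca_pos_def)
qed

lemma pos_part_in_ca_pos: "pos_part \<nu> \<in> ca_pos"
  and neg_part_in_ca_pos: "neg_part \<nu> \<in> ca_pos"
  unfolding pos_part_def neg_part_def by (rule measure_of_in_ca_pos)+

lemma ca_integral_add:
  "ca_integral \<nu> (\<lambda>x. apply_bcontfun f x + apply_bcontfun g x) = ca_integral \<nu> f + ca_integral \<nu> g"
  by (simp add: ca_integral_def ca_pos_integrable pos_part_in_ca_pos neg_part_in_ca_pos)

lemma ca_integral_diff:
  "ca_integral \<nu> (\<lambda>x. apply_bcontfun f x - apply_bcontfun g x) = ca_integral \<nu> f - ca_integral \<nu> g"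
  by (simp add: ca_integral_def ca_pos_integrable pos_part_in_ca_pos neg_part_in_ca_pos)

lemma ca_integral_mult: "ca_integral \<nu> (\<lambda>x. c * apply_bcontfun f x) = c * ca_integral \<nu> f"
  by (simp add: ca_integral_def right_diff_distrib)

lemma bdd_above_abs_bcontfun: "bdd_above ((\<lambda>x. \<bar>apply_bcontfun f x\<bar>) ` K)"
  for f :: "'a::topological_space \<Rightarrow>\<^sub>C real"
  by (auto intro!: bdd_aboveI[where M = "norm f"] abs_apply_bcontfun_le)

lemma is_seminorm_p_seminorm:
  assumes K: "K \<noteq> {}"
  shows "is_seminorm (p_seminorm K \<nu>)"
  unfolding is_seminorm_def
proof (intro conjI allI)
  fix f g :: "'a \<Rightarrow>\<^sub>C real" and c :: real
  have "(SUP x\<in>K. \<bar>(f + g) x\<bar>) \<le> (SUP x\<in>K. \<bar>f x\<bar>) + (SUP x\<in>K. \<bar>g x\<bar>)"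
  proof (rule cSUP_least[OF K])
    fix x assume x: "x \<in> K"
    have "\<bar>f x\<bar> \<le> (SUP x\<in>K. \<bar>f x\<bar>)" "\<bar>g x\<bar> \<le> (SUP x\<in>K. \<bar>g x\<bar>)"
      by (intro cSUP_upper x bdd_above_abs_bcontfun)+
    then show "\<bar>(f + g) x\<bar> \<le> (SUP x\<in>K. \<bar>f x\<bar>) + (SUP x\<in>K. \<bar>g x\<bar>)"
      by (simp add: plus_bcontfun.rep_eq)
  qed
  then show "p_seminorm K \<nu> (f + g) \<le> p_seminorm K \<nu> f + p_seminorm K \<nu> g"
    by (simp add: p_seminorm_def ca_integral_add)
  have le: "(SUP x\<in>K. \<bar>(d *\<^sub>R h) x\<bar>) \<le> \<bar>d\<bar> * (SUP x\<in>K. \<bar>h x\<bar>)" for d and h :: "'a \<Rightarrow>\<^sub>C real"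
  proof (rule cSUP_least[OF K])
    fix x assume x: "x \<in> K"
    have "\<bar>h x\<bar> \<le> (SUP x\<in>K. \<bar>h x\<bar>)" by (intro cSUP_upper x bdd_above_abs_bcontfun)
    then show "\<bar>(d *\<^sub>R h) x\<bar> \<le> \<bar>d\<bar> * (SUP x\<in>K. \<bar>h x\<bar>)"
      by (simp add: scaleR_bcontfun.rep_eq abs_mult mult_left_mono)
  qed
  have "\<bar>c\<bar> * (SUP x\<in>K. \<bar>f x\<bar>) \<le> (SUP x\<in>K. \<bar>(c *\<^sub>R f) x\<bar>)"
  proof (cases "c = 0")
    case True
    then show ?thesis using K by (simp add: zero_bcontfun.rep_eq)
  next
    case False
    have "\<bar>c\<bar> * (SUP x\<in>K. \<bar>f x\<bar>) \<le> \<bar>c\<bar> * (\<bar>1 / c\<bar> * (SUP x\<in>K. \<bar>(c *\<^sub>R f) x\<bar>))"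
      using le[of "1 / c" "c *\<^sub>R f"] False by (intro mult_left_mono) auto
    then show ?thesis using False by simp
  qed
  with le[of c f] have "(SUP x\<in>K. \<bar>(c *\<^sub>R f) x\<bar>) = \<bar>c\<bar> * (SUP x\<in>K. \<bar>f x\<bar>)" by linarith
  then show "p_seminorm K \<nu> (c *\<^sub>R f) = \<bar>c\<bar> * p_seminorm K \<nu> f"
    by (simp add: p_seminorm_def ca_integral_mult abs_mult distrib_left)
qed

lemma abs_apply_le_p_seminorm:
  fixes f :: "'a::topological_space \<Rightarrow>\<^sub>C real"
  assumes "x \<in> K"
  shows "\<bar>f x\<bar> \<le> p_seminorm K \<nu> f"
proof -
  have "\<bar>f x\<bar> \<le> (SUP x\<in>K. \<bar>f x\<bar>)" by (intro cSUP_upper assms bdd_above_abs_bcontfun)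
  then show ?thesis by (simp add: p_seminorm_def)
qed

text \<open>The supremum in the seminorm is nonnegative because \<open>K\<close> has a point; over an empty index set
  the real supremum is an unspecified value.\<close>

lemma abs_ca_integral_le_p_seminorm:
  fixes f :: "'a::topological_space \<Rightarrow>\<^sub>C real"
  assumes "K \<noteq> {}"
  shows "\<bar>ca_integral \<nu> (apply_bcontfun f)\<bar> \<le> p_seminorm K \<nu> f"
proof -
  obtain x where "x \<in> K" using assms by blast
  then have "\<bar>f x\<bar> \<le> (SUP x\<in>K. \<bar>f x\<bar>)" by (intro cSUP_upper bdd_above_abs_bcontfun)
  then have "0 \<le> (SUP x\<in>K. \<bar>f x\<bar>)" by (meson abs_ge_zero order_trans)
  then show ?thesis by (simp add: p_seminorm_def)
qed

lemma zero_in_ca: "(\<lambda>_. 0) \<in> ca"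
  by (simp add: ca_def)

lemma tau_K_seminorms:
  "{p_seminorm K \<nu> |K \<nu>. compact K \<and> K \<noteq> {} \<and> \<nu> \<in> ca} \<noteq> {}"
  "p \<in> {p_seminorm K \<nu> |K \<nu>. compact K \<and> K \<noteq> {} \<and> \<nu> \<in> ca} \<Longrightarrow> is_seminorm p"
proof -
  have "p_seminorm {undefined} (\<lambda>_. 0) \<in> {p_seminorm K \<nu> |K \<nu>. compact K \<and> K \<noteq> {} \<and> \<nu> \<in> ca}"
    using zero_in_ca by (intro CollectI exI conjI) (rule refl, auto)
  then show "{p_seminorm K \<nu> |K \<nu>. compact K \<and> K \<noteq> {} \<and> \<nu> \<in> ca} \<noteq> {}" by blast
qed (use is_seminorm_p_seminorm in blast)

lemma hausdorff_lcs_tau_K: "hausdorff_lcs (tau_K :: ('a::topological_space \<Rightarrow>\<^sub>C real) topology)"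
  unfolding tau_K_def
proof (rule hausdorff_lcs_seminorm_topology[OF tau_K_seminorms])
  fix f :: "'a \<Rightarrow>\<^sub>C real" assume "f \<noteq> 0"
  then obtain x where "f x \<noteq> 0" by (metis bcontfun_eqI zero_bcontfun.rep_eq)
  then have "p_seminorm {x} (\<lambda>_. 0) f \<noteq> 0"
    using abs_apply_le_p_seminorm[of x "{x}" f "\<lambda>_. 0"] by auto
  moreover have "p_seminorm {x} (\<lambda>_. 0) \<in> {p_seminorm K \<nu> |K \<nu>. compact K \<and> K \<noteq> {} \<and> \<nu> \<in> ca}"
    using zero_in_ca by (intro CollectI exI conjI) (rule refl, auto)
  ultimately show "\<exists>p\<in>{p_seminorm K \<nu> |K \<nu>. compact K \<and> K \<noteq> {} \<and> \<nu> \<in> ca}. p f \<noteq> 0" by blast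
qed

lemma limitin_tau_K_iff:
  "limitin tau_K f l F \<longleftrightarrow>
     (\<forall>K \<nu>. compact K \<longrightarrow> K \<noteq> {} \<longrightarrow> \<nu> \<in> ca \<longrightarrow> ((\<lambda>n. p_seminorm K \<nu> (f n - l)) \<longlongrightarrow> 0) F)"
  unfolding tau_K_def
  by (subst limitin_seminorm_topology_iff) (use tau_K_seminorms in blast)+

text \<open>Sequential convergence in \<open>tau_K\<close>, as \<open>limitin_tau_K_sequentially_iff\<close> shows: uniformly bounded,
  and uniformly convergent on compact sets.\<close>

definition boundedly_compactly_tendsto ::
  "(nat \<Rightarrow> 'a::topological_space \<Rightarrow>\<^sub>C real) \<Rightarrow> ('a \<Rightarrow>\<^sub>C real) \<Rightarrow> bool" where
  "boundedly_compactly_tendsto fs f \<longleftrightarrow>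
     (\<exists>B. \<forall>n. norm (fs n) \<le> B) \<and>
     (\<forall>K. compact K \<longrightarrow> (\<forall>e>0. \<forall>\<^sub>F n in sequentially. \<forall>x\<in>K. \<bar>fs n x - f x\<bar> < e))"

lemma boundedly_compactly_tendsto_pointwise:
  assumes "boundedly_compactly_tendsto fs f"
  shows "(\<lambda>n. fs n x) \<longlonglongrightarrow> f x"
proof (rule tendstoI)
  fix e :: real assume "e > 0"
  moreover have "compact {x}" by simp
  ultimately have "\<forall>\<^sub>F n in sequentially. \<forall>y\<in>{x}. \<bar>fs n y - f y\<bar> < e"
    using assms unfolding boundedly_compactly_tendsto_def by blast
  then show "\<forall>\<^sub>F n in sequentially. dist (fs n x) (f x) < e"
    by (simp add: dist_real_def)
qed

text \<open>Dominated convergence: constants are integrable because the measure is finite.\<close>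

lemma boundedly_compactly_tendsto_integral:
  assumes f: "boundedly_compactly_tendsto fs f" and M: "M \<in> ca_pos"
  shows "(\<lambda>n. \<integral>x. fs n x \<partial>M) \<longlonglongrightarrow> (\<integral>x. f x \<partial>M)"
proof -
  interpret finite_measure M by (rule ca_pos_finite[OF M])
  obtain B where B: "\<And>n. norm (fs n) \<le> B"
    using f by (auto simp: boundedly_compactly_tendsto_def)
  show ?thesis
  proof (rule integral_dominated_convergence)
    show "integrable M (\<lambda>_. B)" by simp
    show "AE x in M. (\<lambda>n. fs n x) \<longlonglongrightarrow> f x"
      using boundedly_compactly_tendsto_pointwise[OF f] by simp
    show "AE x in M. norm (fs n x) \<le> B" for n
      using norm_bounded[of "fs n"] B[of n] by (auto intro: order_trans)
  qed (simp_all add: ca_pos_measurable[OF M])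
qed

text \<open>The integrals against finite measures contribute nothing to sequential convergence except the
  uniform bound: they force it by the uniform boundedness principle, and conversely the bound and
  pointwise convergence give convergence of all integrals by dominated convergence. Every limit in
  \<open>tau_K\<close> below is reduced to sequences and then to this criterion.\<close>

theorem limitin_tau_K_sequentially_iff:
  "limitin tau_K fs f sequentially \<longleftrightarrow> boundedly_compactly_tendsto fs f"
proof
  assume lim: "limitin tau_K fs f sequentially"
  have p: "(\<lambda>n. p_seminorm K \<nu> (fs n - f)) \<longlonglongrightarrow> 0" if "compact K" "K \<noteq> {}" "\<nu> \<in> ca" for K \<nu>
    using lim that unfolding limitin_tau_K_iff by blast
  have "\<exists>B. \<forall>n. norm (fs n - f) \<le> B"
  proof (rule norm_bounded_if_integrals_bounded)
    fix M :: "'a measure" assume M: "M \<in> ca_pos"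
    have "(\<lambda>n. ca_integral (measure M) (apply_bcontfun (fs n - f))) \<longlonglongrightarrow> 0"
    proof (rule tendsto_rabs_zero_cancel, rule tendsto_sandwich[OF _ _ tendsto_const p])
      show "\<forall>\<^sub>F n in sequentially. \<bar>ca_integral (measure M) (apply_bcontfun (fs n - f))\<bar>
          \<le> p_seminorm {undefined} (measure M) (fs n - f)"
        by (intro always_eventually allI abs_ca_integral_le_p_seminorm) simp
    qed (use measure_in_ca[OF M] in auto)
    then have "Bseq (\<lambda>n. \<integral>x. (fs n - f) x \<partial>M)"
      using ca_integral_measure[OF M] by (auto intro: convergent_imp_Bseq convergentI)
    then show "\<exists>B. \<forall>n. \<bar>\<integral>x. (fs n - f) x \<partial>M\<bar> \<le> B"
      unfolding Bseq_def by auto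
  qed
  then obtain B where B: "\<And>n. norm (fs n - f) \<le> B" by blast
  have "norm (fs n) \<le> B + norm f" for n
    using norm_triangle_ineq[of "fs n - f" f] B[of n] by simp
  moreover have "\<forall>\<^sub>F n in sequentially. \<forall>x\<in>K. \<bar>fs n x - f x\<bar> < e" if "compact K" "e > 0" for K and e :: real
  proof (cases "K = {}")
    case False
    have "\<forall>\<^sub>F n in sequentially. p_seminorm K (\<lambda>_. 0) (fs n - f) < e"
      using p[OF that(1) False zero_in_ca] that(2) by (auto intro: order_tendstoD)
    then show ?thesis
    proof eventually_elim
      case (elim n)
      show ?case
        using abs_apply_le_p_seminorm[of _ K "fs n - f" "\<lambda>_. 0"] elim
        by (auto simp: minus_bcontfun.rep_eq intro: le_less_trans)
    qed
  qed simp
  ultimately show "boundedly_compactly_tendsto fs f"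
    unfolding boundedly_compactly_tendsto_def by blast
next
  assume f: "boundedly_compactly_tendsto fs f"
  show "limitin tau_K fs f sequentially"
    unfolding limitin_tau_K_iff
  proof (intro allI impI)
    fix K :: "'a set" and \<nu> :: "'a set \<Rightarrow> real" assume K: "compact K" "K \<noteq> {}" and "\<nu> \<in> ca"
    have "(\<lambda>n. SUP x\<in>K. \<bar>(fs n - f) x\<bar>) \<longlonglongrightarrow> 0"
    proof (rule tendstoI)
      fix e :: real assume e: "e > 0"
      then have "\<forall>\<^sub>F n in sequentially. \<forall>x\<in>K. \<bar>fs n x - f x\<bar> < e / 2"
        using f K(1) half_gt_zero[OF e] unfolding boundedly_compactly_tendsto_def by blast
      then show "\<forall>\<^sub>F n in sequentially. dist (SUP x\<in>K. \<bar>(fs n - f) x\<bar>) 0 < e"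
      proof eventually_elim
        case (elim n)
        have "(SUP x\<in>K. \<bar>(fs n - f) x\<bar>) \<le> e / 2"
          using elim by (intro cSUP_least K(2)) (auto simp: minus_bcontfun.rep_eq intro: less_imp_le)
        moreover obtain x where "x \<in> K" using K(2) by blast
        then have "\<bar>(fs n - f) x\<bar> \<le> (SUP x\<in>K. \<bar>(fs n - f) x\<bar>)"
          by (intro cSUP_upper bdd_above_abs_bcontfun)
        ultimately show ?case using e by (auto simp: dist_real_def)
      qed
    qed
    moreover have "(\<lambda>n. ca_integral \<nu> (apply_bcontfun (fs n - f))) \<longlonglongrightarrow> 0"
    proof -
      have "(\<lambda>n. ca_integral \<nu> (fs n)) \<longlonglongrightarrow> ca_integral \<nu> f"
        unfolding ca_integral_def
        by (intro tendsto_diff boundedly_compactly_tendsto_integral[OF f] pos_part_in_ca_pos neg_part_in_ca_pos)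
      moreover have "ca_integral \<nu> (apply_bcontfun (fs n - f)) = ca_integral \<nu> (fs n) - ca_integral \<nu> f" for n
        by (simp add: ca_integral_diff)
      ultimately show ?thesis by (simp add: LIM_zero)
    qed
    ultimately show "(\<lambda>n. p_seminorm K \<nu> (fs n - f)) \<longlonglongrightarrow> 0"
      unfolding p_seminorm_def by (auto intro: tendsto_eq_intros)
  qed
qed

section \<open>Calculus of bounded compact convergence\<close>

lemma boundedly_compactly_tendstoI:
  fixes fs :: "nat \<Rightarrow> 'a::topological_space \<Rightarrow>\<^sub>C real" and f :: "'a \<Rightarrow>\<^sub>C real"
  assumes "\<And>n. norm (fs n) \<le> B"
    "\<And>K e. compact K \<Longrightarrow> e > 0 \<Longrightarrow> \<forall>\<^sub>F n in sequentially. \<forall>x\<in>K. \<bar>fs n x - f x\<bar> < e"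
  shows "boundedly_compactly_tendsto fs f"
  using assms unfolding boundedly_compactly_tendsto_def by blast

lemma boundedly_compactly_tendsto_eventually:
  fixes fs :: "nat \<Rightarrow> 'a::topological_space \<Rightarrow>\<^sub>C real" and f :: "'a \<Rightarrow>\<^sub>C real"
  assumes "boundedly_compactly_tendsto fs f" "compact K" "e > 0"
  shows "\<forall>\<^sub>F n in sequentially. \<forall>x\<in>K. \<bar>fs n x - f x\<bar> < e"
  using assms unfolding boundedly_compactly_tendsto_def by blast

lemma boundedly_compactly_tendsto_bounded:
  fixes fs :: "nat \<Rightarrow> 'a::topological_space \<Rightarrow>\<^sub>C real"
  assumes "boundedly_compactly_tendsto fs f"
  obtains B where "B \<ge> 0" "\<And>n. norm (fs n) \<le> B"
proof -
  obtain B where B: "\<And>n. norm (fs n) \<le> B"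
    using assms by (auto simp: boundedly_compactly_tendsto_def)
  show thesis by (rule that[OF _ B]) (use B[of 0] norm_ge_zero[of "fs 0"] in linarith)
qed

text \<open>The form in which limits are transferred: only the absolute value of the difference matters,
  so changes of sign along the sequence are harmless.\<close>

lemma boundedly_compactly_tendsto_if_dominated:
  fixes fs gs :: "nat \<Rightarrow> 'a::topological_space \<Rightarrow>\<^sub>C real" and f :: "'a \<Rightarrow>\<^sub>C real"
  assumes g: "boundedly_compactly_tendsto gs 0" and le: "\<And>n x. \<bar>fs n x - f x\<bar> \<le> \<bar>gs n x\<bar>"
  shows "boundedly_compactly_tendsto fs f"
proof -
  obtain B where B: "\<And>n. norm (gs n) \<le> B"
    using boundedly_compactly_tendsto_bounded[OF g] by metis
  have "norm (fs n) \<le> B + norm f" for n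
  proof (rule norm_bound)
    fix x
    show "norm (fs n x) \<le> B + norm f"
      using le[of n x] B[of n] abs_apply_bcontfun_le[of "gs n" x] abs_apply_bcontfun_le[of f x] by simp
  qed
  then show ?thesis
  proof (rule boundedly_compactly_tendstoI)
    fix K :: "'a set" and e :: real assume "compact K" "e > 0"
    from boundedly_compactly_tendsto_eventually[OF g this]
    show "\<forall>\<^sub>F n in sequentially. \<forall>x\<in>K. \<bar>fs n x - f x\<bar> < e"
      by eventually_elim (use le in \<open>auto intro: le_less_trans\<close>)
  qed
qed

lemma boundedly_compactly_tendsto_diff_iff:
  fixes fs :: "nat \<Rightarrow> 'a::topological_space \<Rightarrow>\<^sub>C real"
  shows "boundedly_compactly_tendsto (\<lambda>n. fs n - f) 0 \<longleftrightarrow> boundedly_compactly_tendsto fs f"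
proof
  assume "boundedly_compactly_tendsto (\<lambda>n. fs n - f) 0"
  then show "boundedly_compactly_tendsto fs f"
    by (rule boundedly_compactly_tendsto_if_dominated) simp
next
  assume f: "boundedly_compactly_tendsto fs f"
  then obtain B where B: "\<And>n. norm (fs n) \<le> B"
    using boundedly_compactly_tendsto_bounded by metis
  show "boundedly_compactly_tendsto (\<lambda>n. fs n - f) 0"
  proof (rule boundedly_compactly_tendstoI)
    show "norm (fs n - f) \<le> B + norm f" for n
      using norm_triangle_ineq4[of "fs n" f] B[of n] by linarith
  qed (use boundedly_compactly_tendsto_eventually[OF f] in simp)
qed

lemma boundedly_compactly_tendsto_if_norm_tendsto:
  fixes fs :: "nat \<Rightarrow> 'a::topological_space \<Rightarrow>\<^sub>C real"
  assumes "fs \<longlonglongrightarrow> f"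
  shows "boundedly_compactly_tendsto fs f"
proof -
  obtain B where B: "\<And>n. norm (fs n) \<le> B"
    using convergent_imp_Bseq[OF convergentI[OF assms]] by (auto simp: Bseq_def)
  then show ?thesis
  proof (rule boundedly_compactly_tendstoI)
    fix K :: "'a set" and e :: real assume "e > 0"
    then have "\<forall>\<^sub>F n in sequentially. dist (fs n) f < e" by (rule tendstoD[OF assms])
    then show "\<forall>\<^sub>F n in sequentially. \<forall>x\<in>K. \<bar>fs n x - f x\<bar> < e"
    proof eventually_elim
      case (elim n)
      then show ?case
        using abs_apply_bcontfun_le[of "fs n - f"] by (auto simp: dist_norm intro: le_less_trans)
    qed
  qed
qed

lemma boundedly_compactly_tendsto_scaleR:
  fixes fs :: "nat \<Rightarrow> 'a::topological_space \<Rightarrow>\<^sub>C real"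
  assumes c: "c \<longlonglongrightarrow> (l :: real)" and f: "boundedly_compactly_tendsto fs f"
  shows "boundedly_compactly_tendsto (\<lambda>n. c n *\<^sub>R fs n) (l *\<^sub>R f)"
proof -
  let ?X = "tau_K :: ('a \<Rightarrow>\<^sub>C real) topology"
  have cont: "continuous_map (prod_topology euclideanreal ?X) ?X (\<lambda>(c, x). c *\<^sub>R x)"
    using hausdorff_lcs_tau_K unfolding hausdorff_lcs_def by blast
  have "limitin (prod_topology euclideanreal ?X) (\<lambda>n. (c n, fs n)) (l, f) sequentially"
    using c f by (simp add: limitin_pairwise comp_def limitin_tau_K_sequentially_iff)
  from continuous_map_limit[OF cont this] show ?thesis
    by (simp add: comp_def limitin_tau_K_sequentially_iff)
qed

lemma limitin_tau_K_at_topI: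
  fixes f :: "real \<Rightarrow> 'a::topological_space \<Rightarrow>\<^sub>C real"
  assumes "\<And>X. filterlim X at_top sequentially \<Longrightarrow> boundedly_compactly_tendsto (\<lambda>n. f (X n)) l"
  shows "limitin tau_K f l (at_top :: real filter)"
  unfolding limitin_tau_K_iff
proof (intro allI impI tendsto_at_topI_sequentially)
  fix K :: "'a set" and \<nu> :: "'a set \<Rightarrow> real" and X :: "nat \<Rightarrow> real"
  assume "compact K" "K \<noteq> {}" "\<nu> \<in> ca" "filterlim X at_top sequentially"
  then show "(\<lambda>n. p_seminorm K \<nu> (f (X n) - l)) \<longlonglongrightarrow> 0"
    using assms[of X] limitin_tau_K_sequentially_iff[of "\<lambda>n. f (X n)" l]
    unfolding limitin_tau_K_iff by blast
qed

lemma limitin_tau_K_at_rightI: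
  fixes f :: "real \<Rightarrow> 'a::topological_space \<Rightarrow>\<^sub>C real"
  assumes "\<And>X. (\<And>n. X n > a) \<Longrightarrow> X \<longlonglongrightarrow> a \<Longrightarrow> boundedly_compactly_tendsto (\<lambda>n. f (X n)) l"
  shows "limitin tau_K f l (at_right (a :: real))"
  unfolding limitin_tau_K_iff
proof (intro allI impI, rule tendsto_at_right_sequentially[of a "a + 1"])
  fix K :: "'a set" and \<nu> :: "'a set \<Rightarrow> real" and X :: "nat \<Rightarrow> real"
  assume "compact K" "K \<noteq> {}" "\<nu> \<in> ca" "\<And>n. a < X n" "X \<longlonglongrightarrow> a"
  then show "(\<lambda>n. p_seminorm K \<nu> (f (X n) - l)) \<longlonglongrightarrow> 0"
    using assms[of X] limitin_tau_K_sequentially_iff[of "\<lambda>n. f (X n)" l]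
    unfolding limitin_tau_K_iff by blast
qed simp

section \<open>Riemann integrals of continuous curves\<close>

lemma riemann_sum_minus_integral_bound:
  fixes h :: "real \<Rightarrow> real"
  assumes ab: "a \<le> b" and h: "continuous_on {a..b} h" and D: "D tagged_division_of {a..b}"
    and mesh: "\<And>x k. (x, k) \<in> D \<Longrightarrow> measure lborel k < d" and e: "e \<ge> 0"
    and unif: "\<And>s t. s \<in> {a..b} \<Longrightarrow> t \<in> {a..b} \<Longrightarrow> \<bar>s - t\<bar> < d \<Longrightarrow> \<bar>h s - h t\<bar> \<le> e"
  shows "\<bar>(\<Sum>(x, k)\<in>D. measure lborel k * h x) - integral {a..b} h\<bar> \<le> e * (b - a)"
proof -
  have D': "D tagged_division_of cbox a b" using D by simp
  have piece: "\<bar>measure lborel k * h x - integral k h\<bar> \<le> e * measure lborel k" if xk: "(x, k) \<in> D" for x k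
  proof -
    obtain u v where k: "k = cbox u v" using tagged_division_ofD(4)[OF D xk] by blast
    have x: "x \<in> k" using tagged_division_ofD(2)[OF D xk] .
    have sub: "k \<subseteq> {a..b}" using tagged_division_ofD(3)[OF D xk] .
    have uv: "u \<le> v" "measure lborel k = v - u" using x k by auto
    have "continuous_on k h" using h sub by (rule continuous_on_subset)
    then have "(h has_integral integral k h) (cbox u v)"
      unfolding k by (intro integrable_integral integrable_continuous)
    moreover have "((\<lambda>_. h x) has_integral measure lborel k * h x) (cbox u v)"
      using has_integral_const[of "h x" u v] k by simp
    ultimately have "((\<lambda>t. h x - h t) has_integral (measure lborel k * h x - integral k h)) (cbox u v)"
      by (intro has_integral_diff)
    moreover have "norm (h x - h t) \<le> e" if "t \<in> cbox u v" for t
      using unif[of x t] that x sub k mesh[OF xk] uv by auto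
    ultimately have "norm (measure lborel k * h x - integral k h) \<le> e * measure lborel (cbox u v)"
      by (rule has_integral_bound[OF e])
    then show ?thesis by (simp add: k)
  qed
  have "integral {a..b} h = (\<Sum>(x, k)\<in>D. integral k h)"
    using integral_combine_tagged_division_topdown[OF _ D', of h] integrable_continuous[of a b h] h by simp
  then have "\<bar>(\<Sum>(x, k)\<in>D. measure lborel k * h x) - integral {a..b} h\<bar> =
      \<bar>\<Sum>(x, k)\<in>D. measure lborel k * h x - integral k h\<bar>"
    by (simp add: sum_subtractf case_prod_unfold)
  also have "\<dots> \<le> (\<Sum>(x, k)\<in>D. e * measure lborel k)"
    using piece by (intro order_trans[OF sum_abs] sum_mono) auto
  also have "\<dots> = e * (\<Sum>(x, k)\<in>D. measure lborel k)"
    by (simp add: sum_distrib_left case_prod_unfold)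
  also have "\<dots> = e * (b - a)"
    using additive_content_tagged_division[OF D'] ab by simp
  finally show ?thesis .
qed

text \<open>Sequential continuity of a curve with respect to \<open>tau_K\<close>.\<close>

definition boundedly_compactly_continuous_on ::
  "real set \<Rightarrow> (real \<Rightarrow> 'a::topological_space \<Rightarrow>\<^sub>C real) \<Rightarrow> bool" where
  "boundedly_compactly_continuous_on S g \<longleftrightarrow>
     (\<forall>t ts. t \<in> S \<longrightarrow> (\<forall>n. ts n \<in> S) \<longrightarrow> ts \<longlonglongrightarrow> t \<longrightarrow>
        boundedly_compactly_tendsto (\<lambda>n. g (ts n)) (g t))"

lemma boundedly_compactly_continuous_on_pointwise:
  assumes "boundedly_compactly_continuous_on S g"
  shows "continuous_on S (\<lambda>t. g t x)"
proof (rule continuous_on_sequentiallyI)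
  fix u t assume "\<forall>n. u n \<in> S" "t \<in> S" "u \<longlonglongrightarrow> t"
  then show "(\<lambda>n. g (u n) x) \<longlonglongrightarrow> g t x"
    using assms boundedly_compactly_tendsto_pointwise
    unfolding boundedly_compactly_continuous_on_def by blast
qed

text \<open>The Heine--Cantor argument: two nearby parameters at which the values differ by \<open>e\<close> somewhere on
  \<open>K\<close> accumulate at a common point of \<open>S\<close>, where continuity is violated.\<close>

lemma boundedly_compactly_uniformly_continuous:
  fixes g :: "real \<Rightarrow> 'a::topological_space \<Rightarrow>\<^sub>C real"
  assumes g: "boundedly_compactly_continuous_on S g" and S: "compact S" and K: "compact K" and e: "e > 0"
  obtains d where "d > 0" "\<And>s t x. s \<in> S \<Longrightarrow> t \<in> S \<Longrightarrow> \<bar>s - t\<bar> < d \<Longrightarrow> x \<in> K \<Longrightarrow> \<bar>g s x - g t x\<bar> < e"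
proof -
  have "\<exists>d>0. \<forall>s\<in>S. \<forall>t\<in>S. \<bar>s - t\<bar> < d \<longrightarrow> (\<forall>x\<in>K. \<bar>g s x - g t x\<bar> < e)"
  proof (rule ccontr)
    assume neg: "\<not> ?thesis"
    have "\<exists>s t. s \<in> S \<and> t \<in> S \<and> \<bar>s - t\<bar> < inverse (real (Suc n)) \<and> \<not> (\<forall>x\<in>K. \<bar>g s x - g t x\<bar> < e)" for n
    proof -
      have "inverse (real (Suc n)) > 0" by simp
      with neg show ?thesis by blast
    qed
    then obtain s t where st: "\<And>n. s n \<in> S" "\<And>n. t n \<in> S" "\<And>n. \<bar>s n - t n\<bar> < inverse (real (Suc n))"
      "\<And>n. \<not> (\<forall>x\<in>K. \<bar>g (s n) x - g (t n) x\<bar> < e)"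
      by metis
    obtain l r where l: "l \<in> S" "strict_mono r" "(s \<circ> r) \<longlonglongrightarrow> l"
      using S st(1) unfolding compact_def by metis
    have "(\<lambda>n. t n - s n) \<longlonglongrightarrow> 0"
      by (rule Lim_null_comparison[OF _ LIMSEQ_inverse_real_of_nat])
         (use st(3) in \<open>auto simp: abs_minus_commute intro!: always_eventually intro: less_imp_le\<close>)
    then have "((\<lambda>n. t n - s n) \<circ> r) \<longlonglongrightarrow> 0" using l(2) by (rule LIMSEQ_subseq_LIMSEQ)
    from tendsto_add[OF this l(3)] have tl: "(t \<circ> r) \<longlonglongrightarrow> l" by (simp add: comp_def)
    have conv: "boundedly_compactly_tendsto (\<lambda>n. g ((q \<circ> r) n)) (g l)"
      if "(q \<circ> r) \<longlonglongrightarrow> l" "\<And>n. q n \<in> S" for q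
      using g that l(1) unfolding boundedly_compactly_continuous_on_def by (simp add: comp_def)
    have e2: "e / 2 > 0" using e by simp
    have "\<forall>\<^sub>F n in sequentially. False"
      using boundedly_compactly_tendsto_eventually[OF conv[OF l(3) st(1)] K e2]
        boundedly_compactly_tendsto_eventually[OF conv[OF tl st(2)] K e2]
    proof eventually_elim
      case (elim n)
      have "\<bar>g (s (r n)) x - g (t (r n)) x\<bar> < e" if "x \<in> K" for x
        using bspec[OF elim(1) that] bspec[OF elim(2) that] by (simp add: abs_if split: if_splits)
      then show ?case using st(4)[of "r n"] by blast
    qed
    then show False by simp
  qed
  then show thesis using that by metis
qed

text \<open>The integral is formed pointwise in \<open>x\<close>. It is a continuous function of \<open>x\<close> by dominated
  convergence, and the Riemann sums are bounded and converge to it uniformly on compact sets, by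
  uniform continuity of the curve. Since mesh limits can be tested along sequences of tagged
  divisions, convergence in \<open>tau_K\<close> follows from the sequential criterion. A direct estimate of the
  seminorms would instead interchange the integral in time with a measure on the space.\<close>

lemma has_riemann_integral_tau_K:
  fixes g :: "real \<Rightarrow> 'a::metric_space \<Rightarrow>\<^sub>C real"
  assumes ab: "a \<le> b" and g: "boundedly_compactly_continuous_on {a..b} g"
    and B: "\<And>t. t \<in> {a..b} \<Longrightarrow> norm (g t) \<le> B"
  shows "\<exists>G. has_riemann_integral tau_K g a b G \<and> (\<forall>x. G x = integral {a..b} (\<lambda>t. g t x))"
proof -
  note cont = boundedly_compactly_continuous_on_pointwise[OF g]
  have int: "(\<lambda>t. g t x) integrable_on {a..b}" for x
    using cont by (rule integrable_continuous_real)
  have gB: "\<bar>g t x\<bar> \<le> B" if "t \<in> {a..b}" for t x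
    using B[OF that] abs_apply_bcontfun_le[of "g t" x] by linarith
  have B0: "B \<ge> 0" using gB[of a] ab abs_ge_zero order_trans by (metis atLeastAtMost_iff order_refl)
  define G where "G = Bcontfun (\<lambda>x. integral {a..b} (\<lambda>t. g t x))"
  have "continuous_on UNIV (\<lambda>x. integral {a..b} (\<lambda>t. g t x))"
  proof (rule continuous_on_sequentiallyI)
    fix u :: "nat \<Rightarrow> 'a" and x assume u: "u \<longlonglongrightarrow> x"
    show "(\<lambda>n. integral {a..b} (\<lambda>t. g t (u n))) \<longlonglongrightarrow> integral {a..b} (\<lambda>t. g t x)"
    proof (rule dominated_convergence(2)[where h = "\<lambda>_. B"])
      show "(\<lambda>n. g t (u n)) \<longlonglongrightarrow> g t x" for t
        using u continuous_on_tendsto_compose[OF continuous_on_apply_bcontfun[of UNIV "g t"], of u x] by simp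
    qed (use int gB in auto)
  qed
  moreover have "\<bar>integral {a..b} (\<lambda>t. g t x)\<bar> \<le> B * (b - a)" for x
    using integral_bound[OF ab cont, of x B] gB by simp
  ultimately have "(\<lambda>x. integral {a..b} (\<lambda>t. g t x)) \<in> bcontfun"
    by (auto simp: bcontfun_def bounded_iff)
  then have G: "G x = integral {a..b} (\<lambda>t. g t x)" for x
    by (simp add: G_def Bcontfun_inverse)
  have sum_apply: "(\<Sum>(t, k)\<in>D. measure lborel k *\<^sub>R g t) x = (\<Sum>(t, k)\<in>D. measure lborel k * g t x)"
    if "finite D" for D x
    using that by (induction D) auto
  have "has_riemann_integral tau_K g a b G"
    unfolding has_riemann_integral_def
  proof (intro allI impI, rule ccontr)
    fix U :: "('a \<Rightarrow>\<^sub>C real) set" assume "nbhd0 tau_K U"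
    then obtain V where V: "openin tau_K V" "0 \<in> V" "V \<subseteq> U" by (auto simp: nbhd0_def)
    let ?R = "\<lambda>D. \<Sum>(t, k)\<in>D. measure lborel k *\<^sub>R g t"
    assume neg: "\<not> (\<exists>d>0. \<forall>D. D tagged_division_of {a..b} \<longrightarrow> (\<forall>(x, k)\<in>D. measure lborel k < d) \<longrightarrow>
        ?R D \<in> (\<lambda>u. G + u) ` U)"
    have "\<exists>D. D tagged_division_of {a..b} \<and> (\<forall>(x, k)\<in>D. measure lborel k < inverse (real (Suc n))) \<and>
        ?R D \<notin> (\<lambda>u. G + u) ` U" for n
    proof -
      have "inverse (real (Suc n)) > 0" by simp
      with neg show ?thesis by blast
    qed
    then obtain D where D: "\<And>n. D n tagged_division_of {a..b}"
      "\<And>n. \<forall>(x, k)\<in>D n. measure lborel k < inverse (real (Suc n))"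
      "\<And>n. ?R (D n) \<notin> (\<lambda>u. G + u) ` U"
      by metis
    have fin: "finite (D n)" for n using D(1) by (rule tagged_division_ofD(1))
    have "boundedly_compactly_tendsto (\<lambda>n. ?R (D n)) G"
    proof (rule boundedly_compactly_tendstoI)
      fix n
      have tag: "t \<in> {a..b}" if "(t, k) \<in> D n" for t k
        using tagged_division_ofD(2,3)[OF D(1) that] by blast
      have "norm (?R (D n)) \<le> (\<Sum>(t, k)\<in>D n. measure lborel k * B)"
        by (intro order_trans[OF norm_sum] sum_mono) (use B tag in \<open>auto intro!: mult_left_mono\<close>)
      also have "\<dots> = B * (\<Sum>(t, k)\<in>D n. measure lborel k)"
        by (simp add: sum_distrib_left case_prod_unfold mult.commute)
      also have "\<dots> = B * (b - a)"
        using additive_content_tagged_division[of "D n" a b] D(1)[of n] ab by simp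
      finally show "norm (?R (D n)) \<le> B * (b - a)" .
    next
      fix K :: "'a set" and e :: real assume K: "compact K" and e: "e > 0"
      define e' where "e' = e / (b - a + 1)"
      have e': "e' > 0" "e' * (b - a) < e" using e ab by (auto simp: e'_def field_simps)
      obtain d where d: "d > 0"
        "\<And>s t x. s \<in> {a..b} \<Longrightarrow> t \<in> {a..b} \<Longrightarrow> \<bar>s - t\<bar> < d \<Longrightarrow> x \<in> K \<Longrightarrow> \<bar>g s x - g t x\<bar> < e'"
        using boundedly_compactly_uniformly_continuous[OF g compact_Icc K e'(1)] by metis
      have "\<forall>\<^sub>F n in sequentially. inverse (real (Suc n)) < d"
        using LIMSEQ_inverse_real_of_nat d(1) by (rule order_tendstoD)
      then show "\<forall>\<^sub>F n in sequentially. \<forall>x\<in>K. \<bar>?R (D n) x - G x\<bar> < e"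
      proof eventually_elim
        case (elim n)
        show ?case
        proof
          fix x assume x: "x \<in> K"
          have "\<bar>(\<Sum>(t, k)\<in>D n. measure lborel k * g t x) - integral {a..b} (\<lambda>t. g t x)\<bar> \<le> e' * (b - a)"
          proof (rule riemann_sum_minus_integral_bound[OF ab cont D(1), where d = d])
            show "measure lborel k < d" if "(t, k) \<in> D n" for t k
              using D(2)[of n] that elim by force
            show "\<bar>g s x - g t x\<bar> \<le> e'" if "s \<in> {a..b}" "t \<in> {a..b}" "\<bar>s - t\<bar> < d" for s t
              using d(2)[OF that x] by simp
          qed (use e' in simp)
          then show "\<bar>?R (D n) x - G x\<bar> < e"
            using e'(2) by (simp add: sum_apply[OF fin] G)
        qed
      qed
    qed
    then have "limitin tau_K (\<lambda>n. ?R (D n) - G) 0 sequentially"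
      by (simp add: limitin_tau_K_sequentially_iff boundedly_compactly_tendsto_diff_iff)
    then have "\<forall>\<^sub>F n in sequentially. ?R (D n) - G \<in> V"
      using V unfolding limitin_def by blast
    then obtain n where "?R (D n) - G \<in> V" by (auto simp: eventually_sequentially)
    then have "?R (D n) \<in> (\<lambda>u. G + u) ` U"
      using V(3) by (intro image_eqI[of _ _ "?R (D n) - G"]) auto
    with D(3)[of n] show False by blast
  qed
  with G show ?thesis by blast
qed

lemma integral_exp_minus_le:
  fixes b :: real
  assumes "b > 0" "s \<le> t"
  shows "(\<lambda>r. exp (- b * r)) integrable_on {s..t}" "integral {s..t} (\<lambda>r. exp (- b * r)) \<le> exp (- b * s) / b"
proof -
  have "((\<lambda>r. exp (- b * r)) has_integral (- exp (- b * t) / b - - exp (- b * s) / b)) {s..t}"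
  proof (rule fundamental_theorem_of_calculus[OF assms(2)])
    fix r
    show "((\<lambda>r. - exp (- b * r) / b) has_vector_derivative exp (- b * r)) (at r within {s..t})"
      unfolding has_real_derivative_iff_has_vector_derivative[symmetric]
      using assms(1) by (auto intro!: derivative_eq_intros)
  qed
  then show "(\<lambda>r. exp (- b * r)) integrable_on {s..t}" "integral {s..t} (\<lambda>r. exp (- b * r)) \<le> exp (- b * s) / b"
    using assms(1) by (auto simp: integral_unique has_integral_integrable divide_right_mono)
qed

text \<open>Exponential decay makes the integrals over \<open>{0..s}\<close> Cauchy for the sup norm as \<open>s\<close> grows, and the
  sup norm is complete. So the limit exists even in norm, although the integrals over bounded
  intervals exist only in \<open>tau_K\<close>.\<close>

lemma has_generalized_riemann_integral_tau_K:
  fixes g :: "real \<Rightarrow> 'a::metric_space \<Rightarrow>\<^sub>C real"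
  assumes g: "boundedly_compactly_continuous_on {0..} g" and b: "b > 0" and C: "C \<ge> 0"
    and bnd: "\<And>t. t \<ge> 0 \<Longrightarrow> norm (g t) \<le> C * exp (- b * t)"
  shows "\<exists>y. has_generalized_riemann_integral tau_K g y"
proof -
  have ga: "boundedly_compactly_continuous_on {0..a} g" for a
    using g unfolding boundedly_compactly_continuous_on_def by auto
  have "\<exists>G. has_riemann_integral tau_K g 0 a G \<and> (\<forall>x. G x = integral {0..a} (\<lambda>t. g t x))" if "a \<ge> 0" for a
  proof (rule has_riemann_integral_tau_K[OF that ga])
    fix t assume t: "t \<in> {0..a}"
    then have "C * exp (- b * t) \<le> C" using C b by (intro mult_left_le) auto
    then show "norm (g t) \<le> C" using bnd[of t] t by simp
  qed
  then obtain G where G: "\<And>a. a \<ge> 0 \<Longrightarrow> has_riemann_integral tau_K g 0 a (G a)"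
    "\<And>a x. a \<ge> 0 \<Longrightarrow> G a x = integral {0..a} (\<lambda>t. g t x)"
    by metis
  have cont: "continuous_on {0..} (\<lambda>t. g t x)" for x
    by (rule boundedly_compactly_continuous_on_pointwise[OF g])
  define r where "r s = C * exp (- b * s) / b" for s
  have dist: "norm (G t - G s) \<le> r s" if st: "0 \<le> s" "s \<le> t" for s t
  proof (rule norm_bound)
    fix x
    have int: "(\<lambda>t. g t x) integrable_on {u..t}" if "u \<ge> 0" for u
      by (rule integrable_continuous_real[OF continuous_on_subset[OF cont]]) (use that in auto)
    have "(G t - G s) x = integral {s..t} (\<lambda>t. g t x)"
      using Henstock_Kurzweil_Integration.integral_combine[where a = 0 and c = s and b = t and f = "\<lambda>t. g t x"] int[of 0] st by (simp add: G(2))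
    also have "norm \<dots> \<le> integral {s..t} (\<lambda>t. C * exp (- b * t))"
    proof (rule integral_norm_bound_integral)
      show "(\<lambda>t. C * exp (- b * t)) integrable_on {s..t}"
        using integrable_on_cmult_left[OF integral_exp_minus_le(1)[OF b st(2)], of C] by simp
      show "norm (g u x) \<le> C * exp (- b * u)" if "u \<in> {s..t}" for u
        using abs_apply_bcontfun_le[of "g u" x] bnd[of u] that st by simp
    qed (use int st in simp)
    also have "\<dots> \<le> r s"
      using mult_left_mono[OF integral_exp_minus_le(2)[OF b st(2)] C] by (simp add: r_def)
    finally show "norm ((G t - G s) x) \<le> r s" .
  qed
  have r0: "(r \<longlongrightarrow> 0) at_top"
  proof -
    have "filterlim (\<lambda>s. b * s) at_top at_top"
      by (rule filterlim_tendsto_pos_mult_at_top[OF tendsto_const b filterlim_ident])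
    then have "((\<lambda>s. exp (- (b * s))) \<longlongrightarrow> 0) at_top"
      by (intro filterlim_compose[OF exp_at_bot] filterlim_compose[OF filterlim_uminus_at_bot_at_top])
    then have "((\<lambda>s. C * exp (- (b * s)) / b) \<longlongrightarrow> C * 0 / b) at_top"
      using b by (intro tendsto_intros) auto
    then show ?thesis by (simp add: r_def[abs_def])
  qed
  have rn: "(\<lambda>n. r (real n)) \<longlonglongrightarrow> 0"
    by (rule filterlim_compose[OF r0 filterlim_real_sequentially])
  have "Cauchy (\<lambda>n. G (real n))"
  proof (rule metric_CauchyI)
    fix e :: real assume "e > 0"
    then have "e / 2 > 0" by simp
    from order_tendstoD(2)[OF rn this] obtain N where N: "r (real N) < e / 2"
      by (auto simp: eventually_sequentially)
    have "dist (G (real m)) (G (real n)) < e" if "m \<ge> N" "n \<ge> N" for m n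
      using dist[of "real N" "real m"] dist[of "real N" "real n"] that N
        dist_triangle2[of "G (real m)" "G (real n)" "G (real N)"]
      by (simp add: dist_norm)
    then show "\<exists>N. \<forall>m\<ge>N. \<forall>n\<ge>N. dist (G (real m)) (G (real n)) < e" by blast
  qed
  then obtain y where y: "(\<lambda>n. G (real n)) \<longlonglongrightarrow> y"
    using Cauchy_convergent_iff convergent_def by blast
  have "norm (y - G s) \<le> r s" if "s \<ge> 0" for s
  proof (rule LIMSEQ_le_const2)
    show "(\<lambda>n. norm (G (real n) - G s)) \<longlonglongrightarrow> norm (y - G s)"
      by (intro tendsto_norm tendsto_diff y tendsto_const)
    show "\<exists>N. \<forall>n\<ge>N. norm (G (real n) - G s) \<le> r s"
      using dist[OF that] real_arch_simple[of s] by (meson of_nat_mono order_trans)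
  qed
  then have "\<forall>\<^sub>F s in at_top. norm (G s - y) \<le> r s"
    by (intro eventually_mono[OF eventually_ge_at_top[of 0]]) (simp add: norm_minus_commute)
  then have lim: "(G \<longlongrightarrow> y) at_top"
    by (intro LIM_zero_cancel[OF Lim_null_comparison[OF _ r0]])
  have "limitin tau_K G y at_top"
    by (intro limitin_tau_K_at_topI boundedly_compactly_tendsto_if_norm_tendsto filterlim_compose[OF lim])
  with G(1) show ?thesis
    unfolding has_generalized_riemann_integral_def by blast
qed

section \<open>Transition families\<close>

text \<open>Meant for two cases: a compact set \<open>A\<close> that carries most of the mass, and a small ball
  \<open>A\<close> on which \<open>h\<close> is small.\<close>

lemma abs_integral_le_split:
  fixes h :: "'a::topological_space \<Rightarrow> real"
  assumes M: "M \<in> ca_pos" and h: "h \<in> borel_measurable M" and A: "A \<in> sets borel"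
    and d: "0 \<le> d" "\<And>x. x \<in> A \<Longrightarrow> \<bar>h x\<bar> \<le> d" and b: "\<And>x. \<bar>h x\<bar> \<le> b"
  shows "\<bar>\<integral>x. h x \<partial>M\<bar> \<le> d * measure M UNIV + b * measure M (- A)"
proof -
  interpret finite_measure M by (rule ca_pos_finite[OF M])
  note [simp] = ca_pos_space[OF M] ca_pos_sets[OF M]
  have A': "- A \<in> sets borel" using A by (simp add: borel_comp)
  then have int: "integrable M (\<lambda>x. d + b * indicator (- A) x)"
    by (auto intro!: integrable_real_indicator simp: emeasure_eq_measure)
  have "\<bar>\<integral>x. h x \<partial>M\<bar> \<le> (\<integral>x. \<bar>h x\<bar> \<partial>M)"
    by (rule integral_abs_bound)
  also have "\<dots> \<le> (\<integral>x. d + b * indicator (- A) x \<partial>M)"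
  proof (rule integral_mono[OF _ int])
    show "integrable M (\<lambda>x. \<bar>h x\<bar>)"
      by (rule integrable_const_bound[where B = b]) (use h b in auto)
    show "\<bar>h x\<bar> \<le> d + b * indicator (- A) x" for x
      using d b[of x] by (cases "x \<in> A") auto
  qed
  also have "\<dots> = d * measure M UNIV + b * measure M (- A)"
    using A' by (subst Bochner_Integration.integral_add) (auto simp: emeasure_eq_measure)
  finally show ?thesis .
qed

text \<open>Stronger than uniform continuity on \<open>K\<close>: only one of the two points has to lie in \<open>K\<close>. The space
  need not be locally compact, so this cannot be read off from a compact neighbourhood of \<open>K\<close>; a
  Lebesgue number of a cover of \<open>K\<close> by open sets of small oscillation gives it.\<close>

lemma uniformly_continuous_near_compact:
  fixes f :: "'a::metric_space \<Rightarrow> real"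
  assumes f: "continuous_on UNIV f" and K: "compact K" and e: "e > 0"
  obtains d where "d > 0" "\<And>x y. x \<in> K \<Longrightarrow> dist x y < d \<Longrightarrow> \<bar>f y - f x\<bar> < e"
proof -
  let ?G = "range (\<lambda>z. f -` ball z (e / 2))"
  have "x \<in> f -` ball (f x) (e / 2)" for x using e by simp
  then have cover: "K \<subseteq> \<Union>?G" by blast
  have "\<exists>d>0. \<forall>x\<in>K. \<exists>G\<in>?G. ball x d \<subseteq> G"
  proof (rule Heine_Borel_lemma[OF K cover])
    show "open G" if "G \<in> ?G" for G using that f by (auto intro: open_vimage)
  qed (intro exI conjI ballI)
  then obtain d where d: "d > 0" "\<forall>x\<in>K. \<exists>G\<in>?G. ball x d \<subseteq> G" by blast
  have "\<bar>f y - f x\<bar> < e" if xy: "x \<in> K" "dist x y < d" for x y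
  proof -
    obtain z where z: "ball x d \<subseteq> f -` ball z (e / 2)" using bspec[OF d(2) xy(1)] by blast
    have "x \<in> ball x d" "y \<in> ball x d" using xy d(1) by auto
    then have "x \<in> f -` ball z (e / 2)" "y \<in> f -` ball z (e / 2)" using z by blast+
    then have "dist z (f x) < e / 2" "dist z (f y) < e / 2" by simp_all
    then show ?thesis by (auto simp: dist_real_def abs_if split: if_splits)
  qed
  with d(1) show thesis by (rule that)
qed

locale transition_family =
  fixes \<mu> :: "real \<Rightarrow> 'a::metric_space \<Rightarrow> 'a measure" and C :: real
  assumes ca_pos: "0 \<le> t \<Longrightarrow> \<mu> t \<xi> \<in> ca_pos"
    and mass_le: "0 \<le> t \<Longrightarrow> measure (\<mu> t \<xi>) UNIV \<le> C"
    and initial: "\<Gamma> \<in> sets borel \<Longrightarrow> measure (\<mu> 0 \<xi>) \<Gamma> = indicator \<Gamma> \<xi>"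
    and feller: "0 \<le> t \<Longrightarrow> continuous_on UNIV (\<lambda>\<xi>. \<integral>x. (f :: 'a \<Rightarrow>\<^sub>C real) x \<partial>\<mu> t \<xi>)"
    and chapman_kolmogorov: "0 \<le> t \<Longrightarrow> 0 \<le> s \<Longrightarrow>
      (\<integral>x. (f :: 'a \<Rightarrow>\<^sub>C real) x \<partial>\<mu> (t + s) \<xi>) = (\<integral>y. (\<integral>x. f x \<partial>\<mu> t y) \<partial>\<mu> s \<xi>)"
    and tight: "0 < R \<Longrightarrow> compact K \<Longrightarrow> 0 < \<epsilon> \<Longrightarrow> \<exists>K0. compact K0 \<and>
      (\<forall>t\<in>{0..R}. \<forall>\<xi>\<in>K. measure (\<mu> t \<xi>) K0 > measure (\<mu> t \<xi>) UNIV - \<epsilon>)"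
    and concentrated: "0 < r \<Longrightarrow> compact K \<Longrightarrow> K \<noteq> {} \<Longrightarrow>
      ((\<lambda>t. SUP \<xi>\<in>K. \<bar>measure (\<mu> t \<xi>) (ball \<xi> r) - 1\<bar>) \<longlongrightarrow> 0) (at_right 0)"
begin

abbreviation T where "T \<equiv> transition_op \<mu>"

lemma C_nonneg: "0 \<le> C"
  using mass_le[of 0] measure_nonneg order_trans by blast

lemma T_apply: "0 \<le> t \<Longrightarrow> T t f \<xi> = (\<integral>x. f x \<partial>\<mu> t \<xi>)"
  by (rule transition_op_apply[where C = C]) (simp_all add: ca_pos mass_le ca_norm_measure feller)

lemma measure_mono_borel:
  assumes "0 \<le> t" "B \<in> sets borel" "A \<subseteq> B"
  shows "measure (\<mu> t \<xi>) A \<le> measure (\<mu> t \<xi>) B"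
proof -
  interpret finite_measure "\<mu> t \<xi>" by (rule ca_pos_finite[OF ca_pos[OF assms(1)]])
  show ?thesis
    using assms ca_pos_sets[OF ca_pos[OF assms(1)]] by (intro finite_measure_mono) auto
qed

lemma measure_compl:
  assumes "0 \<le> t" "A \<in> sets borel"
  shows "measure (\<mu> t \<xi>) (- A) = measure (\<mu> t \<xi>) UNIV - measure (\<mu> t \<xi>) A"
proof -
  note M = ca_pos[OF assms(1), of \<xi>]
  interpret finite_measure "\<mu> t \<xi>" by (rule ca_pos_finite[OF M])
  show ?thesis
    using finite_measure_compl[of A] assms(2) ca_pos_space[OF M] ca_pos_sets[OF M]
    by (simp add: Compl_eq_Diff_UNIV)
qed

lemma norm_T_le:
  assumes "0 \<le> t"
  shows "norm (T t f) \<le> C * norm f"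
proof (rule norm_bound)
  fix \<xi>
  have "\<bar>T t f \<xi>\<bar> \<le> norm f * measure (\<mu> t \<xi>) UNIV + norm f * measure (\<mu> t \<xi>) (- UNIV)"
    unfolding T_apply[OF assms]
    by (rule abs_integral_le_split[OF ca_pos[OF assms]])
       (simp_all add: ca_pos_measurable[OF ca_pos[OF assms]] abs_apply_bcontfun_le)
  also have "\<dots> \<le> C * norm f"
    using mult_left_mono[OF mass_le[OF assms, of \<xi>] norm_ge_zero[of f]] by (simp add: mult.commute)
  finally show "norm (T t f \<xi>) \<le> C * norm f" by simp
qed

lemma linear_T:
  assumes t: "0 \<le> t"
  shows "linear (T t)"
proof (rule linearI)
  fix f g :: "'a \<Rightarrow>\<^sub>C real" and c :: real
  show "T t (f + g) = T t f + T t g"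
    by (rule bcontfun_eqI) (simp add: T_apply[OF t] ca_pos_integrable[OF ca_pos[OF t]])
  show "T t (c *\<^sub>R f) = c *\<^sub>R T t f"
    by (rule bcontfun_eqI) (simp add: T_apply[OF t])
qed

lemma T_semigroup:
  assumes "0 \<le> t" "0 \<le> s"
  shows "T (t + s) f = T t (T s f)"
proof (rule bcontfun_eqI)
  fix \<xi>
  have "T (s + t) f \<xi> = T t (T s f) \<xi>"
    using assms by (simp add: T_apply chapman_kolmogorov)
  then show "T (t + s) f \<xi> = T t (T s f) \<xi>" by (simp add: add.commute)
qed

text \<open>Three errors are added: the oscillation of \<open>f\<close> on \<open>A\<close>, the mass that escapes from \<open>A\<close>, and the
  defect of the total mass from \<open>1\<close>, since the \<open>\<mu> t \<xi>\<close> need not be probability measures.\<close>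

lemma T_minus_identity_bound:
  fixes f :: "'a \<Rightarrow>\<^sub>C real"
  assumes t: "0 \<le> t" and A: "A \<in> sets borel" and d: "0 \<le> d" "\<And>x. x \<in> A \<Longrightarrow> \<bar>f x - f \<xi>\<bar> \<le> d"
  shows "\<bar>T t f \<xi> - f \<xi>\<bar> \<le> d * C + 2 * norm f * measure (\<mu> t \<xi>) (- A)
    + norm f * \<bar>measure (\<mu> t \<xi>) UNIV - 1\<bar>"
proof -
  note M = ca_pos[OF t, of \<xi>]
  interpret finite_measure "\<mu> t \<xi>" by (rule ca_pos_finite[OF M])
  have meas: "(\<lambda>x. f x - f \<xi>) \<in> borel_measurable (\<mu> t \<xi>)"
    using ca_pos_measurable[OF M, of f] by simp
  have "(\<integral>x. f x - f \<xi> \<partial>\<mu> t \<xi>) = T t f \<xi> - f \<xi> * measure (\<mu> t \<xi>) UNIV"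
    by (simp add: T_apply[OF t] ca_pos_integrable[OF M] ca_pos_space[OF M])
  then have "T t f \<xi> - f \<xi> = (\<integral>x. f x - f \<xi> \<partial>\<mu> t \<xi>) + f \<xi> * (measure (\<mu> t \<xi>) UNIV - 1)"
    by (simp add: algebra_simps)
  then have "\<bar>T t f \<xi> - f \<xi>\<bar> \<le> \<bar>\<integral>x. f x - f \<xi> \<partial>\<mu> t \<xi>\<bar> + \<bar>f \<xi>\<bar> * \<bar>measure (\<mu> t \<xi>) UNIV - 1\<bar>"
    by (metis abs_mult abs_triangle_ineq)
  also have "\<bar>\<integral>x. f x - f \<xi> \<partial>\<mu> t \<xi>\<bar> \<le> d * measure (\<mu> t \<xi>) UNIV + 2 * norm f * measure (\<mu> t \<xi>) (- A)"
  proof (rule abs_integral_le_split[OF M meas A d])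
    show "\<bar>f x - f \<xi>\<bar> \<le> 2 * norm f" for x
      using abs_apply_bcontfun_le[of f x] abs_apply_bcontfun_le[of f \<xi>] by linarith
  qed
  also have "d * measure (\<mu> t \<xi>) UNIV \<le> d * C"
    by (intro mult_left_mono mass_le t d)
  also have "\<bar>f \<xi>\<bar> * \<bar>measure (\<mu> t \<xi>) UNIV - 1\<bar> \<le> norm f * \<bar>measure (\<mu> t \<xi>) UNIV - 1\<bar>"
    by (intro mult_right_mono abs_apply_bcontfun_le) simp
  finally show ?thesis by simp
qed

lemma T_0: "T 0 f = f"
proof (rule bcontfun_eqI)
  fix \<xi>
  have "measure (\<mu> 0 \<xi>) (- {\<xi>}) = 0" "measure (\<mu> 0 \<xi>) UNIV = 1"
    using initial[of "- {\<xi>}" \<xi>] initial[of UNIV \<xi>] by auto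
  then show "T 0 f \<xi> = f \<xi>"
    using T_minus_identity_bound[of 0 "{\<xi>}" 0 f \<xi>] by simp
qed

text \<open>Up to time \<open>R\<close> and for starting points in \<open>K\<close>, tightness confines the mass to one compact set
  \<open>K0\<close> up to a small error. The functions are uniformly small on \<open>K0\<close>, and off \<open>K0\<close> their common
  bound suffices.\<close>

lemma T_locally_equicontinuous:
  assumes t: "\<And>n. t n \<in> {0..R}" and f: "boundedly_compactly_tendsto fs 0"
  shows "boundedly_compactly_tendsto (\<lambda>n. T (t n) (fs n)) 0"
proof -
  obtain B where B: "B \<ge> 0" "\<And>n. norm (fs n) \<le> B"
    using boundedly_compactly_tendsto_bounded[OF f] by metis
  have t0: "0 \<le> t n" for n using t[of n] by simp
  show ?thesis
  proof (rule boundedly_compactly_tendstoI)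
    show "norm (T (t n) (fs n)) \<le> C * B" for n
      using norm_T_le[OF t0] mult_left_mono[OF B(2) C_nonneg] by (rule order_trans)
  next
    fix K :: "'a set" and e :: real assume K: "compact K" and e: "e > 0"
    \<comment> \<open>\<open>R\<close> may be \<open>0\<close>, whereas tightness is assumed for intervals of positive length\<close>
    have "R + 1 > 0" using t[of 0] by simp
    moreover have "e / (2 * (B + 1)) > 0" using e B(1) by simp
    ultimately obtain K0 where K0: "compact K0"
      "\<And>s \<xi>. s \<in> {0..R + 1} \<Longrightarrow> \<xi> \<in> K \<Longrightarrow> measure (\<mu> s \<xi>) K0 > measure (\<mu> s \<xi>) UNIV - e / (2 * (B + 1))"
      using tight[OF _ K] by metis
    have K0b: "K0 \<in> sets borel" using K0(1) by (simp add: borel_compact)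
    have d: "e / (2 * (C + 1)) > 0" using e C_nonneg by simp
    from boundedly_compactly_tendsto_eventually[OF f K0(1) this]
    show "\<forall>\<^sub>F n in sequentially. \<forall>\<xi>\<in>K. \<bar>T (t n) (fs n) \<xi> - apply_bcontfun 0 \<xi>\<bar> < e"
    proof eventually_elim
      case (elim n)
      show ?case
      proof
        fix \<xi> assume \<xi>: "\<xi> \<in> K"
        have "\<bar>T (t n) (fs n) \<xi>\<bar> \<le>
            e / (2 * (C + 1)) * measure (\<mu> (t n) \<xi>) UNIV + B * measure (\<mu> (t n) \<xi>) (- K0)"
          unfolding T_apply[OF t0]
        proof (rule abs_integral_le_split[OF ca_pos[OF t0] ca_pos_measurable[OF ca_pos[OF t0]] K0b])
          show "\<bar>fs n x\<bar> \<le> e / (2 * (C + 1))" if "x \<in> K0" for x using elim that by force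
          show "\<bar>fs n x\<bar> \<le> B" for x using abs_apply_bcontfun_le B(2) by (rule order_trans)
        qed (use d in simp)
        also have "e / (2 * (C + 1)) * measure (\<mu> (t n) \<xi>) UNIV \<le> e / (2 * (C + 1)) * C"
          by (intro mult_left_mono mass_le t0) (use d in simp)
        also have "\<dots> < e / 2" using e C_nonneg by (simp add: field_simps)
        also have "B * measure (\<mu> (t n) \<xi>) (- K0) \<le> B * (e / (2 * (B + 1)))"
          using K0(2)[of "t n" \<xi>] t[of n] \<xi> B(1)
          by (intro mult_left_mono) (auto simp: measure_compl[OF t0 K0b])
        also have "\<dots> \<le> e / 2" using e B(1) by (simp add: field_simps)
        finally show "\<bar>T (t n) (fs n) \<xi> - apply_bcontfun 0 \<xi>\<bar> < e" by simp
      qed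
    qed
  qed
qed

text \<open>Tightness gives no control over long times, but there the discount factor makes the bounded
  functions \<open>T t f\<close> small in norm. Before that time, local equicontinuity applies.\<close>

lemma discounted_T_equicontinuous:
  assumes \<alpha>: "\<alpha> > 0" and t: "\<And>n. 0 \<le> t n" and f: "boundedly_compactly_tendsto fs 0"
  shows "boundedly_compactly_tendsto (\<lambda>n. exp (- \<alpha> * t n) *\<^sub>R T (t n) (fs n)) 0"
proof -
  obtain B where B: "B \<ge> 0" "\<And>n. norm (fs n) \<le> B"
    using boundedly_compactly_tendsto_bounded[OF f] by metis
  have TB: "norm (T (t n) (fs n)) \<le> C * B" for n
    using norm_T_le[OF t] mult_left_mono[OF B(2) C_nonneg] by (rule order_trans)
  have CB: "C * B \<ge> 0" using C_nonneg B(1) by simp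
  have exp_le: "exp (- \<alpha> * t n) \<le> 1" for n using \<alpha> t[of n] by simp
  show ?thesis
  proof (rule boundedly_compactly_tendstoI)
    show "norm (exp (- \<alpha> * t n) *\<^sub>R T (t n) (fs n)) \<le> C * B" for n
      using mult_mono[OF exp_le TB] by simp
  next
    fix K :: "'a set" and e :: real assume K: "compact K" and e: "e > 0"
    \<comment> \<open>after time \<open>R\<close> the factor \<open>exp (- \<alpha> * s)\<close> is at most \<open>e / (C * B + 1)\<close>\<close>
    define R where "R = \<bar>ln (e / (C * B + 1))\<bar> / \<alpha>"
    have R: "R \<ge> 0" using \<alpha> by (simp add: R_def)
    have late: "exp (- \<alpha> * s) * (C * B) < e" if "s > R" for s
    proof -
      have "\<alpha> * R < \<alpha> * s" using that \<alpha> by simp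
      then have "- \<alpha> * s \<le> ln (e / (C * B + 1))" using \<alpha> by (simp add: R_def)
      then have "exp (- \<alpha> * s) \<le> exp (ln (e / (C * B + 1)))" by (simp only: exp_le_cancel_iff)
      also have "\<dots> = e / (C * B + 1)" using e CB by (intro exp_ln) simp
      finally have "exp (- \<alpha> * s) \<le> e / (C * B + 1)" .
      then have "exp (- \<alpha> * s) * (C * B) \<le> e / (C * B + 1) * (C * B)" by (intro mult_right_mono CB)
      also have "\<dots> < e" using e CB by (simp add: field_simps)
      finally show ?thesis .
    qed
    have "boundedly_compactly_tendsto (\<lambda>n. T (min (t n) R) (fs n)) 0"
      by (rule T_locally_equicontinuous[OF _ f, of _ R]) (use t R in auto)
    from boundedly_compactly_tendsto_eventually[OF this K e]
    show "\<forall>\<^sub>F n in sequentially. \<forall>\<xi>\<in>K. \<bar>(exp (- \<alpha> * t n) *\<^sub>R T (t n) (fs n)) \<xi> - apply_bcontfun 0 \<xi>\<bar> < e"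
    proof eventually_elim
      case (elim n)
      have "exp (- \<alpha> * t n) * \<bar>T (t n) (fs n) \<xi>\<bar> < e" if \<xi>: "\<xi> \<in> K" for \<xi>
      proof (cases "t n \<le> R")
        case True
        have "exp (- \<alpha> * t n) * \<bar>T (t n) (fs n) \<xi>\<bar> \<le> \<bar>T (t n) (fs n) \<xi>\<bar>"
          using exp_le by (intro mult_left_le_one_le) auto
        also have "\<dots> < e" using elim \<xi> True by (simp add: min_absorb1)
        finally show ?thesis .
      next
        case False
        have "\<bar>T (t n) (fs n) \<xi>\<bar> \<le> C * B" using abs_apply_bcontfun_le TB by (rule order_trans)
        then have "exp (- \<alpha> * t n) * \<bar>T (t n) (fs n) \<xi>\<bar> \<le> exp (- \<alpha> * t n) * (C * B)"
          by (intro mult_left_mono) auto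
        also have "\<dots> < e" using False by (intro late) simp
        finally show ?thesis .
      qed
      then show ?case by (simp add: abs_mult)
    qed
  qed
qed

text \<open>The assumption \<open>concentrated\<close> only speaks of balls of a fixed radius, which leaves open whether
  mass escapes to infinity. Tightness excludes this: a large ball around every point of \<open>K\<close>
  contains the compact set \<open>K0\<close> that carries the mass up to \<open>\<eta>\<close>, so that the total mass also tends
  to \<open>1\<close> uniformly on \<open>K\<close>. Consequently the mass outside a small ball tends to \<open>0\<close>, and \<open>f\<close> varies
  little inside it.\<close>

lemma T_uniformly_near_identity:
  fixes f :: "'a \<Rightarrow>\<^sub>C real"
  assumes K: "compact K" "K \<noteq> {}" and e: "e > 0"
  shows "\<forall>\<^sub>F t in at_right 0. \<forall>\<xi>\<in>K. \<bar>T t f \<xi> - f \<xi>\<bar> < e"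
proof -
  \<comment> \<open>the final estimate is \<open>\<eta> * (C + 6 * norm f + 2 * norm f)\<close>\<close>
  define \<eta> where "\<eta> = e / (C + 8 * norm f + 1)"
  have pos: "C + 8 * norm f + 1 > 0" using C_nonneg norm_ge_zero[of f] by linarith
  have \<eta>: "\<eta> > 0" using e pos by (simp add: \<eta>_def)
  have "\<eta> * (C + 8 * norm f) < \<eta> * (C + 8 * norm f + 1)" using \<eta> by simp
  also have "\<dots> = e" using pos by (simp add: \<eta>_def)
  finally have \<eta>e: "\<eta> * (C + 8 * norm f) < e" .
  obtain r where r: "r > 0" "\<And>\<xi> x. \<xi> \<in> K \<Longrightarrow> dist \<xi> x < r \<Longrightarrow> \<bar>f x - f \<xi>\<bar> < \<eta>"
    using uniformly_continuous_near_compact[OF _ K(1) \<eta>, of f] continuous_on_apply_bcontfun by metis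
  obtain K0 where K0: "compact K0"
    "\<And>t \<xi>. t \<in> {0..1} \<Longrightarrow> \<xi> \<in> K \<Longrightarrow> measure (\<mu> t \<xi>) K0 > measure (\<mu> t \<xi>) UNIV - \<eta>"
    using tight[OF zero_less_one K(1) \<eta>] by metis
  have "bounded (K \<union> K0)" using K(1) K0(1) by (simp add: compact_imp_bounded)
  then obtain b where b: "\<And>x y. x \<in> K \<union> K0 \<Longrightarrow> y \<in> K \<union> K0 \<Longrightarrow> dist x y \<le> b"
    unfolding bounded_two_points by blast
  define r' where "r' = \<bar>b\<bar> + 1"
  have r': "r' > 0" by (simp add: r'_def)
  have K0_ball: "K0 \<subseteq> ball \<xi> r'" if "\<xi> \<in> K" for \<xi>
    using b[of \<xi>] that by (fastforce simp: r'_def)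
  have ball_mass: "\<forall>\<^sub>F t in at_right 0. \<forall>\<xi>\<in>K. \<bar>measure (\<mu> t \<xi>) (ball \<xi> q) - 1\<bar> < \<eta>" if q: "q > 0" for q
  proof -
    have "\<forall>\<^sub>F t in at_right 0. (SUP \<xi>\<in>K. \<bar>measure (\<mu> t \<xi>) (ball \<xi> q) - 1\<bar>) < \<eta>"
      using concentrated[OF q K] \<eta> by (rule order_tendstoD)
    moreover have "\<forall>\<^sub>F t in at_right 0. 0 < (t :: real)" by (simp add: eventually_at_right_less)
    ultimately show ?thesis
    proof eventually_elim
      case (elim t)
      have bd: "\<bar>measure (\<mu> t \<xi>) (ball \<xi> q) - 1\<bar> \<le> C + 1" for \<xi>
      proof -
        have "measure (\<mu> t \<xi>) (ball \<xi> q) \<le> measure (\<mu> t \<xi>) UNIV"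
          using elim(2) by (intro measure_mono_borel) auto
        also have "\<dots> \<le> C" using elim(2) by (intro mass_le) simp
        finally show ?thesis
          using measure_nonneg[of "\<mu> t \<xi>" "ball \<xi> q"] by (simp only: abs_le_iff) linarith
      qed
      show ?case
      proof
        fix \<xi> assume "\<xi> \<in> K"
        then have "\<bar>measure (\<mu> t \<xi>) (ball \<xi> q) - 1\<bar> \<le> (SUP \<xi>\<in>K. \<bar>measure (\<mu> t \<xi>) (ball \<xi> q) - 1\<bar>)"
          by (intro cSUP_upper bdd_aboveI[where M = "C + 1"]) (use bd in auto)
        with elim(1) show "\<bar>measure (\<mu> t \<xi>) (ball \<xi> q) - 1\<bar> < \<eta>" by simp
      qed
    qed
  qed
  have "\<forall>\<^sub>F t in at_right 0. (t :: real) \<in> {0<..<1}"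
    by (rule eventually_at_right_real) simp
  with ball_mass[OF r(1)] ball_mass[OF r'] show ?thesis
  proof eventually_elim
    case (elim t)
    then have t: "0 \<le> t" "t \<in> {0..1}" by auto
    show ?case
    proof
      fix \<xi> assume \<xi>: "\<xi> \<in> K"
      let ?m = "measure (\<mu> t \<xi>)"
      have "?m K0 \<le> ?m (ball \<xi> r')" by (rule measure_mono_borel[OF t(1) _ K0_ball[OF \<xi>]]) simp
      moreover have "?m (ball \<xi> r) \<le> ?m UNIV" by (rule measure_mono_borel[OF t(1)]) simp_all
      ultimately have mass: "\<bar>?m UNIV - 1\<bar> \<le> 2 * \<eta>" and outside: "?m (- ball \<xi> r) \<le> 3 * \<eta>"
        using bspec[OF elim(1) \<xi>] bspec[OF elim(2) \<xi>] K0(2)[OF t(2) \<xi>]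
        by (simp_all add: measure_compl[OF t(1)] abs_if split: if_splits)
      have "\<bar>T t f \<xi> - f \<xi>\<bar> \<le> \<eta> * C + 2 * norm f * ?m (- ball \<xi> r) + norm f * \<bar>?m UNIV - 1\<bar>"
        by (rule T_minus_identity_bound[OF t(1)]) (use r(2)[OF \<xi>] \<eta> in \<open>auto intro: less_imp_le\<close>)
      also have "\<dots> \<le> \<eta> * C + 2 * norm f * (3 * \<eta>) + norm f * (2 * \<eta>)"
        by (intro add_mono mult_left_mono mass outside order_refl) simp_all
      also have "\<dots> = \<eta> * (C + 8 * norm f)" by (simp add: algebra_simps)
      also have "\<dots> < e" by (rule \<eta>e)
      finally show "\<bar>T t f \<xi> - f \<xi>\<bar> < e" .
    qed
  qed
qed

lemma T_tendsto_identity: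
  assumes t: "\<And>n. 0 \<le> t n" "t \<longlonglongrightarrow> 0"
  shows "boundedly_compactly_tendsto (\<lambda>n. T (t n) f) f"
proof (rule boundedly_compactly_tendstoI)
  show "norm (T (t n) f) \<le> C * norm f" for n by (rule norm_T_le[OF t(1)])
next
  fix K :: "'a set" and e :: real assume K: "compact K" and e: "e > 0"
  show "\<forall>\<^sub>F n in sequentially. \<forall>\<xi>\<in>K. \<bar>T (t n) f \<xi> - f \<xi>\<bar> < e"
  proof (cases "K = {}")
    case False
    from T_uniformly_near_identity[OF K False e, of f]
    obtain d where d: "d > 0" "\<And>s. 0 < s \<Longrightarrow> s < d \<Longrightarrow> \<forall>\<xi>\<in>K. \<bar>T s f \<xi> - f \<xi>\<bar> < e"
      unfolding eventually_at_right_field by auto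
    have "\<forall>\<^sub>F n in sequentially. t n < d" using t(2) d(1) by (rule order_tendstoD)
    then show ?thesis
    proof eventually_elim
      case (elim n)
      show ?case
      proof (cases "t n = 0")
        case True
        then show ?thesis using e by (simp add: T_0)
      next
        case False
        then show ?thesis using d(2)[of "t n"] elim t(1)[of n] by simp
      qed
    qed
  qed simp
qed

text \<open>Right and left continuity at \<open>t\<close> are treated at once. With \<open>s\<close> the smaller and \<open>s + h\<close> the
  larger of two times, the difference of the values is \<open>T s\<close> applied to \<open>T h f - f\<close>, up to sign;
  the latter tends to \<open>0\<close>, and the operators \<open>T s\<close> with \<open>s\<close> below \<open>t\<close> are equicontinuous.\<close>

lemma T_orbit_continuous: "boundedly_compactly_continuous_on {0..} (\<lambda>t. T t f)"
  unfolding boundedly_compactly_continuous_on_def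
proof (intro allI impI)
  fix t :: real and u assume t: "t \<in> {0..}" and u: "\<forall>n. u n \<in> {0..}" "u \<longlonglongrightarrow> t"
  define s where "s n = min (u n) t" for n
  define h where "h n = \<bar>u n - t\<bar>" for n
  have s: "s n \<in> {0..t}" and h: "0 \<le> h n" for n using t u(1) by (auto simp: s_def h_def)
  have "h \<longlonglongrightarrow> 0" unfolding h_def using u(2) by (simp add: tendsto_rabs_zero LIM_zero)
  then have "boundedly_compactly_tendsto (\<lambda>n. T (h n) f - f) 0"
    using T_tendsto_identity[OF h] by (simp add: boundedly_compactly_tendsto_diff_iff)
  then have "boundedly_compactly_tendsto (\<lambda>n. T (s n) (T (h n) f - f)) 0"
    by (rule T_locally_equicontinuous[OF s])
  then show "boundedly_compactly_tendsto (\<lambda>n. T (u n) f) (T t f)"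
  proof (rule boundedly_compactly_tendsto_if_dominated)
    fix n \<xi>
    have s0: "0 \<le> s n" using s[of n] by simp
    have "T (s n) (T (h n) f - f) = T (s n + h n) f - T (s n) f"
      by (simp add: linear_diff[OF linear_T[OF s0]] T_semigroup[OF s0 h])
    moreover have "s n + h n = u n \<and> s n = t \<or> s n + h n = t \<and> s n = u n"
      by (auto simp: s_def h_def min_def)
    ultimately show "\<bar>T (u n) f \<xi> - T t f \<xi>\<bar> \<le> \<bar>T (s n) (T (h n) f - f) \<xi>\<bar>"
      by (auto simp: abs_minus_commute)
  qed
qed

lemma discounted_orbit_continuous:
  "boundedly_compactly_continuous_on {0..} (\<lambda>t. exp (- \<alpha> * t) *\<^sub>R T t f)"
  unfolding boundedly_compactly_continuous_on_def
proof (intro allI impI)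
  fix t :: real and u assume t: "t \<in> {0..}" "\<forall>n. u n \<in> {0..}" "u \<longlonglongrightarrow> t"
  have "(\<lambda>n. exp (- \<alpha> * u n)) \<longlonglongrightarrow> exp (- \<alpha> * t)"
    by (intro tendsto_intros t)
  moreover have "boundedly_compactly_tendsto (\<lambda>n. T (u n) f) (T t f)"
    using T_orbit_continuous t unfolding boundedly_compactly_continuous_on_def by blast
  ultimately show "boundedly_compactly_tendsto (\<lambda>n. exp (- \<alpha> * u n) *\<^sub>R T (u n) f) (exp (- \<alpha> * t) *\<^sub>R T t f)"
    by (rule boundedly_compactly_tendsto_scaleR)
qed

lemma C0_semigroup_discounted_T: "C0_semigroup tau_K (\<lambda>t f. exp (- \<alpha> * t) *\<^sub>R T t f)"
  unfolding C0_semigroup_def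
proof (intro conjI allI impI)
  show "hausdorff_lcs (tau_K :: ('a \<Rightarrow>\<^sub>C real) topology)" by (rule hausdorff_lcs_tau_K)
  show "linear (\<lambda>f. exp (- \<alpha> * t) *\<^sub>R T t f)" if "t \<ge> 0" for t
    using linear_T[OF that] by (rule linear_compose_scale_right)
  show "(\<lambda>f. exp (- \<alpha> * 0) *\<^sub>R T 0 f) = id" by (auto simp: T_0)
  show "(\<lambda>f. exp (- \<alpha> * (t + s)) *\<^sub>R T (t + s) f) =
      (\<lambda>f. exp (- \<alpha> * t) *\<^sub>R T t f) \<circ> (\<lambda>f. exp (- \<alpha> * s) *\<^sub>R T s f)" if ts: "t \<ge> 0" "s \<ge> 0" for t s
  proof
    fix f
    have "exp (- \<alpha> * (t + s)) = exp (- \<alpha> * t) * exp (- \<alpha> * s)"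
      by (simp add: exp_add[symmetric] algebra_simps)
    then show "exp (- \<alpha> * (t + s)) *\<^sub>R T (t + s) f =
        ((\<lambda>f. exp (- \<alpha> * t) *\<^sub>R T t f) \<circ> (\<lambda>f. exp (- \<alpha> * s) *\<^sub>R T s f)) f"
      by (simp add: T_semigroup[OF ts] linear_scale[OF linear_T[OF ts(1)]])
  qed
  show "limitin tau_K (\<lambda>t. exp (- \<alpha> * t) *\<^sub>R T t f) f (at_right 0)" for f
  proof (rule limitin_tau_K_at_rightI)
    fix X :: "nat \<Rightarrow> real" assume "\<And>n. X n > 0" "X \<longlonglongrightarrow> 0"
    then have "boundedly_compactly_tendsto (\<lambda>n. exp (- \<alpha> * X n) *\<^sub>R T (X n) f) (exp (- \<alpha> * 0) *\<^sub>R T 0 f)"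
      by (intro discounted_orbit_continuous[unfolded boundedly_compactly_continuous_on_def, rule_format])
         (auto intro: less_imp_le)
    then show "boundedly_compactly_tendsto (\<lambda>n. exp (- \<alpha> * X n) *\<^sub>R T (X n) f) f"
      by (simp add: T_0)
  qed
qed

text \<open>For linear operators equicontinuity at \<open>0\<close> is enough.\<close>

lemma linear_seq_equicontinuousI:
  fixes S :: "real \<Rightarrow> ('a \<Rightarrow>\<^sub>C real) \<Rightarrow> ('a \<Rightarrow>\<^sub>C real)"
  assumes lin: "\<And>t. t \<in> I \<Longrightarrow> linear (S t)"
    and eq: "\<And>t fs. (\<And>n. t n \<in> I) \<Longrightarrow> boundedly_compactly_tendsto fs 0 \<Longrightarrow>
      boundedly_compactly_tendsto (\<lambda>n. S (t n) (fs n)) 0"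
  shows "seq_equicontinuous tau_K I S"
proof (rule seq_equicontinuousI)
  fix t :: "nat \<Rightarrow> real" and fs and f :: "'a \<Rightarrow>\<^sub>C real"
  assume t: "\<And>n. t n \<in> I" and "limitin tau_K fs f sequentially"
  then have "boundedly_compactly_tendsto (\<lambda>n. fs n - f) 0"
    by (simp add: limitin_tau_K_sequentially_iff boundedly_compactly_tendsto_diff_iff)
  then have "boundedly_compactly_tendsto (\<lambda>n. S (t n) (fs n - f)) 0"
    by (intro eq t)
  then show "limitin tau_K (\<lambda>n. S (t n) (fs n) - S (t n) f) 0 sequentially"
    by (simp add: limitin_tau_K_sequentially_iff linear_diff[OF lin[OF t]])
qed

lemma C0_seq_locally_equicontinuous_semigroup_T: "C0_seq_locally_equicontinuous_semigroup tau_K T"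
  unfolding C0_seq_locally_equicontinuous_semigroup_def
proof (intro conjI allI impI)
  show "C0_semigroup tau_K T" using C0_semigroup_discounted_T[of 0] by simp
  show "seq_equicontinuous tau_K {0..R} T" for R
  proof (rule linear_seq_equicontinuousI)
    fix t :: "nat \<Rightarrow> real" and fs :: "nat \<Rightarrow> 'a \<Rightarrow>\<^sub>C real"
    assume "\<And>n. t n \<in> {0..R}" "boundedly_compactly_tendsto fs 0"
    then show "boundedly_compactly_tendsto (\<lambda>n. T (t n) (fs n)) 0"
      by (rule T_locally_equicontinuous)
  qed (simp add: linear_T)
qed

lemma C0_seq_equicontinuous_semigroup_discounted_T:
  assumes "\<alpha> > 0"
  shows "C0_seq_equicontinuous_semigroup tau_K (\<lambda>t f. exp (- \<alpha> * t) *\<^sub>R T t f)"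
  unfolding C0_seq_equicontinuous_semigroup_def
proof (intro conjI C0_semigroup_discounted_T linear_seq_equicontinuousI)
  show "linear (\<lambda>f. exp (- \<alpha> * t) *\<^sub>R T t f)" if "t \<in> {0..}" for t
    using that by (intro linear_compose_scale_right linear_T) simp
  fix t :: "nat \<Rightarrow> real" and fs :: "nat \<Rightarrow> 'a \<Rightarrow>\<^sub>C real"
  assume "\<And>n. t n \<in> {0..}" "boundedly_compactly_tendsto fs 0"
  then show "boundedly_compactly_tendsto (\<lambda>n. exp (- \<alpha> * t n) *\<^sub>R T (t n) (fs n)) 0"
    by (intro discounted_T_equicontinuous[OF assms]) auto
qed

lemma laplace_transform_exists:
  assumes "\<alpha> > 0" "l > 0"
  shows "\<exists>y. has_generalized_riemann_integral tau_K (\<lambda>t. exp (- l * t) *\<^sub>R (exp (- \<alpha> * t) *\<^sub>R T t f)) y"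
proof -
  have "\<exists>y. has_generalized_riemann_integral tau_K (\<lambda>t. exp (- (l + \<alpha>) * t) *\<^sub>R T t f) y"
  proof (rule has_generalized_riemann_integral_tau_K[OF discounted_orbit_continuous])
    show "norm (exp (- (l + \<alpha>) * t) *\<^sub>R T t f) \<le> C * norm f * exp (- (l + \<alpha>) * t)" if "t \<ge> 0" for t
      using norm_T_le[OF that, of f] by (simp add: mult.commute mult_left_mono)
  qed (use assms C_nonneg in auto)
  moreover have "exp (- (l + \<alpha>) * t) = exp (- l * t) * exp (- \<alpha> * t)" for t
    by (simp add: exp_add[symmetric] algebra_simps)
  ultimately show ?thesis by simp
qed

end

section \<open>The semigroup on bounded continuous functions\<close>

theorem proposition5p2:
  fixes \<mu> :: "real \<Rightarrow> 'a::metric_space \<Rightarrow> 'a measure"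
  assumes meas: "\<forall>t\<ge>0. \<forall>\<xi>. \<mu> t \<xi> \<in> ca_pos"
    and A1: "(\<exists>C. \<forall>t\<ge>0. \<forall>\<xi>. ca_norm (measure (\<mu> t \<xi>)) \<le> C) \<and>
      (\<forall>\<xi>. \<forall>\<Gamma>\<in>sets borel. measure (\<mu> 0 \<xi>) \<Gamma> = indicator \<Gamma> \<xi>)"
    and A2: "\<forall>f::'a \<Rightarrow>\<^sub>C real. \<forall>t\<ge>0. continuous_on UNIV (\<lambda>\<xi>. \<integral>x. f x \<partial>\<mu> t \<xi>)"
    and A3: "\<forall>f::'a \<Rightarrow>\<^sub>C real. \<forall>t\<ge>0. \<forall>s\<ge>0. \<forall>\<xi>.
      (\<integral>x. f x \<partial>\<mu> (t + s) \<xi>) = (\<integral>y. (\<integral>x. f x \<partial>\<mu> t y) \<partial>\<mu> s \<xi>)"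
    and A4: "\<forall>R>0. \<forall>K. compact K \<longrightarrow>
      (\<forall>\<epsilon>>0. \<exists>K0. compact K0 \<and>
        (\<forall>t\<in>{0..R}. \<forall>\<xi>\<in>K. measure (\<mu> t \<xi>) K0 > measure (\<mu> t \<xi>) UNIV - \<epsilon>))"
    and A5: "\<forall>r>0. \<forall>K. compact K \<longrightarrow> K \<noteq> {} \<longrightarrow>
      ((\<lambda>t. SUP \<xi>\<in>K. \<bar>measure (\<mu> t \<xi>) (ball \<xi> r) - 1\<bar>) \<longlongrightarrow> 0) (at_right 0)"
  shows "C0_seq_locally_equicontinuous_semigroup tau_K (transition_op \<mu>) \<and>
    (\<forall>\<alpha>>0.
      C0_seq_equicontinuous_semigroup tau_K (\<lambda>t f. exp (- \<alpha> * t) *\<^sub>R transition_op \<mu> t f) \<and>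
      (\<forall>f. \<forall>l>0. \<exists>y. has_generalized_riemann_integral tau_K
         (\<lambda>t. exp (- l * t) *\<^sub>R (exp (- \<alpha> * t) *\<^sub>R transition_op \<mu> t f)) y))"
proof -
  obtain C where C: "\<And>t \<xi>. t \<ge> 0 \<Longrightarrow> ca_norm (measure (\<mu> t \<xi>)) \<le> C" using A1 by blast
  interpret transition_family \<mu> C
  proof
    show "measure (\<mu> t \<xi>) UNIV \<le> C" if "0 \<le> t" for t \<xi>
      using C[OF that] meas that by (simp add: ca_norm_measure)
    show "\<mu> t \<xi> \<in> ca_pos" if "0 \<le> t" for t \<xi>
      using meas that by simp
    show "measure (\<mu> 0 \<xi>) \<Gamma> = indicator \<Gamma> \<xi>" if "\<Gamma> \<in> sets borel" for \<Gamma> \<xi>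
      using A1 that by simp
    show "continuous_on UNIV (\<lambda>\<xi>. \<integral>x. f x \<partial>\<mu> t \<xi>)" if "0 \<le> t" for t and f :: "'a \<Rightarrow>\<^sub>C real"
      using A2 that by simp
    show "(\<integral>x. f x \<partial>\<mu> (t + s) \<xi>) = (\<integral>y. (\<integral>x. f x \<partial>\<mu> t y) \<partial>\<mu> s \<xi>)"
      if "0 \<le> t" "0 \<le> s" for t s \<xi> and f :: "'a \<Rightarrow>\<^sub>C real"
      using A3 that by simp
    show "\<exists>K0. compact K0 \<and> (\<forall>t\<in>{0..R}. \<forall>\<xi>\<in>K. measure (\<mu> t \<xi>) K0 > measure (\<mu> t \<xi>) UNIV - \<epsilon>)"
      if "0 < R" "compact K" "0 < \<epsilon>" for R \<epsilon> K
      using A4[rule_format, OF that] .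
    show "((\<lambda>t. SUP \<xi>\<in>K. \<bar>measure (\<mu> t \<xi>) (ball \<xi> r) - 1\<bar>) \<longlongrightarrow> 0) (at_right 0)"
      if "0 < r" "compact K" "K \<noteq> {}" for r K
      using A5[rule_format, OF that] .
  qed
  show ?thesis
    using C0_seq_locally_equicontinuous_semigroup_T C0_seq_equicontinuous_semigroup_discounted_T
      laplace_transform_exists by blast
qed

end
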